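(* Let $r\geq 1$ be an integer. For every integer $n\geq 2$, the function $\zeta_r(s)$ has exactly $r-1$ zeros in the open real interval $(-2n,-2(n-1))$.
   Context: For an integer $r\geq 1$ and $s\in\mathbb{C}$, $\zeta_r(s)=\zeta_r(s,s,\ldots,s)=\sum_{1\leq m_1<m_2<\cdots<m_r}(m_1m_2\cdots m_r)^{-s}$ is the Euler–Zagier $r$-fold zeta-function with all arguments equal; the series converges absolutely for $\Re s>1$, and $\zeta_r(s)$ is understood via its meromorphic continuation to $\mathbb{C}$ (it is holomorphic on the negative real axis). *)

theory Defs
  imports "HOL-Complex_Analysis.Complex_Analysis"
begin

text \<open>The tuples \<open>1 \<le> m\<^sub>1 < m\<^sub>2 < \<dots> < m\<^sub>r\<close> of integers, as strictly increasing lists.\<close>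

definition increasing_tuples :: "nat \<Rightarrow> nat list set" where
  "increasing_tuples r =
     {ms. length ms = r \<and> sorted_wrt (<) ms \<and> (\<forall>m\<in>set ms. 1 \<le> m)}"

text \<open>
  \<^const>\<open>infsum\<close> is the unordered sum, which for complex terms means absolute convergence; the
  value is meaningful for \<open>Re s > 1\<close> and is only used there.
\<close>

definition multizeta_series :: "nat \<Rightarrow> complex \<Rightarrow> complex" where
  "multizeta_series r s =
     (\<Sum>\<^sub>\<infinity>ms\<in>increasing_tuples r. of_nat (prod_list ms) powr (- s))"

text \<open>
  A function that is \<^const>\<open>meromorphic_on\<close> a set may take arbitrary values at isolated points.
  With \<^const>\<open>nicely_meromorphic_on\<close> it is continuous off its poles and 0 at its poles,
  so by the identity theorem the continuation is unique as a function and its value at every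
  regular point is the right one.
\<close>

definition multizeta :: "nat \<Rightarrow> complex \<Rightarrow> complex" where
  "multizeta r =
     (THE f. f nicely_meromorphic_on UNIV \<and> (\<forall>s. Re s > 1 \<longrightarrow> f s = multizeta_series r s))"

end

theory Submission
  imports Defs
begin

text \<open>
  Newton's identities express \<open>\<zeta>\<^sub>r(s)\<close> as a polynomial in \<open>\<zeta>(s), \<zeta>(2s), \<dots>, \<zeta>(rs)\<close>, which also gives
  the continuation. For \<open>s = -x < 0\<close> the functional equation turns \<open>\<zeta>(-kx)\<close> into
  \<open>- (2\<pi>)\<^sup>-\<^sup>k\<^sup>x sin (\<pi>kx/2) M(kx) / \<pi>\<close> with \<open>M(y) = \<Gamma>(1+y) \<zeta>(1+y)\<close>. Of all monomials the one
  coming from \<open>\<zeta>(rs)\<close> dominates, because \<open>M(kx) M(jx) / M((k+j)x)\<close> is at most about the reciprocal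
  of the binomial coefficient \<open>2(k+j)\<close> over \<open>2k\<close> for \<open>x \<ge> 2\<close>. After normalisation \<open>\<zeta>\<^sub>r(-x)\<close> is
  therefore \<open>sin (\<pi>rx/2)\<close> plus a perturbation that is small together with its derivative and
  vanishes at the even integers; such a sum has exactly one zero near each of the \<open>r - 1\<close> zeros of
  the sine inside an interval between consecutive even integers.

  The functional equation for \<open>-1 < s < 0\<close> comes from writing the errors of the trapezoidal rule as
  Gamma integrals, summing under the integral sign, and expanding the hyperbolic cotangent that
  appears into partial fractions.
\<close>

section \<open>Newton's identities\<close>

text \<open>The difficulty is uniformity in \<open>r\<close>: Newton's recursion yields ever more
  monomials, yet the perturbation must obey fixed bounds. A summand for the pair (k, r - k) carries
  (5/4)^2 / (r (2 r - 1)), from two zeta values and the binomial coefficient, and there are only r -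
  1 summands, so the total stays bounded. The derivative may grow like \<open>r\<close>, but so does
  the frequency of the sine. These estimates are made for x >= 2, the range that n >= 2 provides.
  Exact vanishing at even integers settles the ends of the interval: sine and perturbation vanish
  there together, and monotonicity excludes further zeros nearby. For the functional equation one
  strip is enough: on Re s <= -1 the reflected formula serves as the definition of the continuation,
  and the overlap -1 < Re s < 0 glues the two pieces. The trapezoidal rule suits this because its
  error has the nonnegative kernel u (1 - u), so that sums and integrals are exchanged for
  nonnegative terms only, and because its error series converges for Re s > -1, just past the line
  Re s = 0.\<close>

definition tuples_upto :: "nat \<Rightarrow> nat \<Rightarrow> nat list set" where
  "tuples_upto r N = {ms \<in> increasing_tuples r. \<forall>m\<in>set ms. m \<le> N}"

lemma tuples_upto_0 [simp]: "tuples_upto 0 N = {[]}"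
  by (auto simp: tuples_upto_def increasing_tuples_def)

lemma tuples_upto_Suc_0 [simp]: "tuples_upto (Suc r) 0 = {}"
  by (auto simp: tuples_upto_def increasing_tuples_def length_Suc_conv)

lemma tuples_upto_Suc_Suc:
  "tuples_upto (Suc r) (Suc N) =
     tuples_upto (Suc r) N \<union> (\<lambda>ms. ms @ [Suc N]) ` tuples_upto r N"
proof (intro equalityI subsetI)
  fix ms assume "ms \<in> tuples_upto (Suc r) (Suc N)"
  then have ms: "length ms = Suc r" "sorted_wrt (<) ms" "\<forall>m\<in>set ms. 1 \<le> m \<and> m \<le> Suc N"
    by (auto simp: tuples_upto_def increasing_tuples_def)
  then obtain ns m where nsm: "ms = ns @ [m]"
    by (metis append_butlast_last_id length_0_conv nat.distinct(1))
  have lt: "\<forall>k\<in>set ns. k < m"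
    using ms nsm by (auto simp: sorted_wrt_append)
  show "ms \<in> tuples_upto (Suc r) N \<union> (\<lambda>ms. ms @ [Suc N]) ` tuples_upto r N"
  proof (cases "m = Suc N")
    case True
    then have "ns \<in> tuples_upto r N"
      using ms nsm lt by (auto simp: tuples_upto_def increasing_tuples_def sorted_wrt_append)
    then show ?thesis using nsm True by auto
  next
    case False
    then have "m \<le> N" using ms nsm by auto
    then have "ms \<in> tuples_upto (Suc r) N"
      using ms nsm lt by (force simp: tuples_upto_def increasing_tuples_def)
    then show ?thesis by auto
  qed
next
  fix ms assume "ms \<in> tuples_upto (Suc r) N \<union> (\<lambda>ms. ms @ [Suc N]) ` tuples_upto r N"
  then show "ms \<in> tuples_upto (Suc r) (Suc N)"
    by (force simp: tuples_upto_def increasing_tuples_def sorted_wrt_append)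
qed

lemma finite_tuples_upto: "finite (tuples_upto r N)"
proof (rule finite_subset)
  show "tuples_upto r N \<subseteq> {ms. set ms \<subseteq> {..N} \<and> length ms = r}"
    by (auto simp: tuples_upto_def increasing_tuples_def)
qed (simp add: finite_lists_length_eq)

text \<open>Stated over any commutative ring because it is used at the complex terms themselves and
  at their norms, where it bounds sums of absolute values.\<close>

definition elem_sym :: "(nat \<Rightarrow> 'a) \<Rightarrow> nat \<Rightarrow> nat \<Rightarrow> 'a :: comm_ring_1" where
  "elem_sym x r N = (\<Sum>ms\<in>tuples_upto r N. prod_list (map x ms))"

lemma elem_sym_0 [simp]: "elem_sym x 0 N = 1"
  and elem_sym_Suc_0 [simp]: "elem_sym x (Suc r) 0 = 0"
  by (simp_all add: elem_sym_def)

lemma elem_sym_Suc_Suc: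
  "elem_sym x (Suc r) (Suc N) = elem_sym x (Suc r) N + x (Suc N) * elem_sym x r N"
proof -
  have "elem_sym x (Suc r) (Suc N) = elem_sym x (Suc r) N +
      (\<Sum>ms\<in>(\<lambda>ms. ms @ [Suc N]) ` tuples_upto r N. prod_list (map x ms))"
    unfolding elem_sym_def tuples_upto_Suc_Suc
    by (rule sum.union_disjoint) (auto simp: finite_tuples_upto, auto simp: tuples_upto_def)
  also have "(\<Sum>ms\<in>(\<lambda>ms. ms @ [Suc N]) ` tuples_upto r N. prod_list (map x ms))
      = x (Suc N) * elem_sym x r N"
    by (subst sum.reindex) (auto simp: inj_on_def elem_sym_def sum_distrib_left mult.commute)
  finally show ?thesis .
qed

definition power_sum :: "(nat \<Rightarrow> 'a) \<Rightarrow> nat \<Rightarrow> nat \<Rightarrow> 'a :: comm_ring_1" where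
  "power_sum x k N = (\<Sum>m=1..N. x m ^ k)"

text \<open>These are the terms of the inductive step below that contain no power sum of the old
  variables. Multiplied out, the second half of each summand cancels the first half of the
  next.\<close>

lemma newton_telescope:
  fixes y :: "'a :: comm_ring_1"
  shows "(\<Sum>k<r. (-1) ^ k * y ^ Suc k * (e (r - k) + y * (if Suc k \<le> r then e (r - Suc k) else 0)))
     = y * e r - (-1) ^ r * y ^ Suc r * e 0"
proof -
  have "(\<Sum>k<r. (-1) ^ k * y ^ Suc k * (e (r - k) + y * (if Suc k \<le> r then e (r - Suc k) else 0)))
      = (\<Sum>k<r. (-1) ^ k * y ^ Suc k * e (r - k) - (-1) ^ Suc k * y ^ Suc (Suc k) * e (r - Suc k))"
    by (rule sum.cong) (auto simp: algebra_simps)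
  also have "\<dots> = (-1) ^ 0 * y ^ Suc 0 * e (r - 0) - (-1) ^ r * y ^ Suc r * e (r - r)"
    by (rule sum_lessThan_telescope')
  finally show ?thesis by simp
qed

text \<open>Induction on the number of variables, for all degrees at once. A new variable y adds y^k
  to the k-th power sum and y times the symmetric function of degree one less. The terms with old
  power sums are the hypothesis in degree \<open>Suc r\<close> plus y times the one in degree
  \<open>r\<close>; the rest telescopes.\<close>

lemma newton_identity_finite:
  "of_nat (Suc r) * elem_sym x (Suc r) N =
     (\<Sum>k\<le>r. (-1) ^ k * power_sum x (Suc k) N * elem_sym x (r - k) N)"
proof (induction N arbitrary: r)
  case 0
  then show ?case by (simp add: power_sum_def)
next
  case (Suc N)
  define y where "y = x (Suc N)"
  define e where "e = (\<lambda>r. elem_sym x r N)"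
  define p where "p = (\<lambda>k. power_sum x k N)"
  have IH: "of_nat (Suc r) * e (Suc r) = (\<Sum>k\<le>r. (-1) ^ k * p (Suc k) * e (r - k))" for r
    using Suc.IH[of r] by (simp add: e_def p_def)
  have e0: "e 0 = 1" by (simp add: e_def)
  have p': "power_sum x k (Suc N) = p k + y ^ k" for k
    by (simp add: power_sum_def p_def y_def)
  have e': "elem_sym x (Suc j) (Suc N) = e (Suc j) + y * e j" for j
    by (simp add: elem_sym_Suc_Suc e_def y_def)
  have IH': "of_nat r * e r = (\<Sum>k<r. (-1) ^ k * p (Suc k) * e (r - Suc k))"
  proof (cases r)
    case (Suc q)
    then show ?thesis using IH[of q] by (simp add: lessThan_Suc_atMost)
  qed auto
  have "(\<Sum>k\<le>r. (-1) ^ k * power_sum x (Suc k) (Suc N) * elem_sym x (r - k) (Suc N)) =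
     (\<Sum>k<r. (-1) ^ k * (p (Suc k) + y ^ Suc k) * (e (r - k) + y * e (r - Suc k)))
     + (-1) ^ r * (p (Suc r) + y ^ Suc r)"
  proof -
    have "(\<Sum>k<r. (-1) ^ k * power_sum x (Suc k) (Suc N) * elem_sym x (r - k) (Suc N)) =
      (\<Sum>k<r. (-1) ^ k * (p (Suc k) + y ^ Suc k) * (e (r - k) + y * e (r - Suc k)))"
    proof (rule sum.cong)
      fix k assume "k \<in> {..<r}"
      then have "r - k = Suc (r - Suc k)" by auto
      then show "(-1) ^ k * power_sum x (Suc k) (Suc N) * elem_sym x (r - k) (Suc N) =
        (-1) ^ k * (p (Suc k) + y ^ Suc k) * (e (r - k) + y * e (r - Suc k))"
        using e'[of "r - Suc k"] by (simp only: p')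
    qed simp
    then show ?thesis by (simp add: lessThan_Suc_atMost [symmetric] p')
  qed
  also have "(\<Sum>k<r. (-1) ^ k * (p (Suc k) + y ^ Suc k) * (e (r - k) + y * e (r - Suc k)))
    = (\<Sum>k<r. (-1) ^ k * p (Suc k) * e (r - k)) + y * (\<Sum>k<r. (-1) ^ k * p (Suc k) * e (r - Suc k))
     + (\<Sum>k<r. (-1) ^ k * y ^ Suc k * (e (r - k) + y * (if Suc k \<le> r then e (r - Suc k) else 0)))"
    unfolding sum_distrib_left sum.distrib [symmetric]
    by (rule sum.cong) (auto simp: algebra_simps)
  also have "\<dots> = (\<Sum>k<r. (-1) ^ k * p (Suc k) * e (r - k)) + y * (of_nat r * e r)
     + (y * e r - (-1) ^ r * y ^ Suc r * e 0)"
    by (simp only: IH' newton_telescope)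
  also have "(\<Sum>k<r. (-1) ^ k * p (Suc k) * e (r - k)) = of_nat (Suc r) * e (Suc r) - (-1) ^ r * p (Suc r)"
    using IH[of r] e0 by (simp add: lessThan_Suc_atMost [symmetric] del: of_nat_Suc)
  finally show ?case
    by (simp add: e' e_def algebra_simps)
qed

text \<open>Each squarefree monomial of degree \<open>r\<close> occurs in the expansion of the
  \<open>r\<close>-th power of the sum. For a convergent series this becomes a bound independent of
  \<open>N\<close>, hence absolute convergence over all tuples.\<close>

lemma elem_sym_nonneg_le:
  fixes x :: "nat \<Rightarrow> real"
  assumes "\<And>m. x m \<ge> 0"
  shows "0 \<le> elem_sym x r N \<and> elem_sym x r N \<le> power_sum x 1 N ^ r"
proof (induction N arbitrary: r)
  case 0
  then show ?case by (cases r) (auto simp: power_sum_def)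
next
  case (Suc N)
  define p where "p = power_sum x 1 N"
  define y where "y = x (Suc N)"
  have nn: "p \<ge> 0" "y \<ge> 0" using assms by (auto simp: p_def y_def power_sum_def sum_nonneg)
  show ?case
  proof (cases r)
    case [simp]: (Suc q)
    have "elem_sym x r (Suc N) \<le> p ^ Suc q + y * p ^ q"
      using Suc.IH[of "Suc q"] Suc.IH[of q] nn
      by (auto simp: elem_sym_Suc_Suc p_def y_def intro!: add_mono mult_left_mono)
    also have "\<dots> = (p + y) * p ^ q" by (simp add: algebra_simps)
    also have "\<dots> \<le> (p + y) * (p + y) ^ q"
      using nn by (intro mult_left_mono power_mono) auto
    finally have "elem_sym x r (Suc N) \<le> (p + y) ^ r" by simp
    moreover have "p + y = power_sum x 1 (Suc N)" by (simp add: p_def y_def power_sum_def)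
    ultimately show ?thesis
      using Suc.IH[of "Suc q"] Suc.IH[of q] nn by (simp add: elem_sym_Suc_Suc y_def)
  qed auto
qed

text \<open>The truncations are cofinal among the finite sets of tuples, which turns the unordered
  sum into an ordinary limit along \<open>N\<close>.\<close>

lemma finite_subset_tuples_upto:
  assumes "finite S" "S \<subseteq> increasing_tuples r"
  shows "\<exists>N0. \<forall>N\<ge>N0. S \<subseteq> tuples_upto r N"
proof -
  define U where "U = (\<Union>ms\<in>S. set ms)"
  have "finite U" using assms by (auto simp: U_def)
  then obtain N0 where "\<forall>m\<in>U. m \<le> N0" by (meson finite_nat_set_iff_bounded_le)
  then have "S \<subseteq> tuples_upto r N" if "N \<ge> N0" for N
    using assms that by (force simp: tuples_upto_def U_def)
  then show ?thesis by blast
qed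

lemma elem_sym_tendsto_infsum:
  fixes x :: "nat \<Rightarrow> complex"
  assumes "summable (\<lambda>m. norm (x m))"
  shows "(\<lambda>N. elem_sym x r N) \<longlonglongrightarrow> (\<Sum>\<^sub>\<infinity>ms\<in>increasing_tuples r. prod_list (map x ms))"
proof -
  define B where "B = (\<Sum>m. norm (x m))"
  have norm_prod: "norm (prod_list (map x ms)) = prod_list (map (\<lambda>m. norm (x m)) ms)" for ms
    by (induction ms) (auto simp: norm_mult)
  have "(\<lambda>ms. norm (prod_list (map x ms))) summable_on increasing_tuples r"
  proof (rule nonneg_bdd_above_summable_on)
    have "sum (\<lambda>ms. norm (prod_list (map x ms))) S \<le> B ^ r"
      if S: "finite S" "S \<subseteq> increasing_tuples r" for S
    proof -
      obtain N where N: "S \<subseteq> tuples_upto r N"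
        using finite_subset_tuples_upto[OF S] by blast
      have "sum (\<lambda>ms. norm (prod_list (map x ms))) S
          \<le> sum (\<lambda>ms. norm (prod_list (map x ms))) (tuples_upto r N)"
        by (rule sum_mono2) (use N finite_tuples_upto in auto)
      also have "\<dots> = elem_sym (\<lambda>m. norm (x m)) r N"
        by (simp add: elem_sym_def norm_prod)
      also have "\<dots> \<le> power_sum (\<lambda>m. norm (x m)) 1 N ^ r"
        using elem_sym_nonneg_le[of "\<lambda>m. norm (x m)"] by simp
      also have "\<dots> \<le> B ^ r"
        unfolding B_def power_sum_def
        by (intro power_mono) (auto intro!: sum_le_suminf assms sum_nonneg)
      finally show ?thesis .
    qed
    then show "bdd_above (sum (\<lambda>ms. norm (prod_list (map x ms))) ` {F. F \<subseteq> increasing_tuples r \<and> finite F})"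
      by (auto intro!: bdd_aboveI2[where M = "B ^ r"])
  qed auto
  then have "(\<lambda>ms. prod_list (map x ms)) summable_on increasing_tuples r"
    by (rule abs_summable_summable)
  then have "((\<lambda>ms. prod_list (map x ms)) has_sum (\<Sum>\<^sub>\<infinity>ms\<in>increasing_tuples r. prod_list (map x ms)))
      (increasing_tuples r)"
    by simp
  then have lim: "(sum (\<lambda>ms. prod_list (map x ms)) \<longlongrightarrow>
      (\<Sum>\<^sub>\<infinity>ms\<in>increasing_tuples r. prod_list (map x ms))) (finite_subsets_at_top (increasing_tuples r))"
    by (simp add: has_sum_def)
  have "filterlim (tuples_upto r) (finite_subsets_at_top (increasing_tuples r)) sequentially"
    unfolding filterlim_finite_subsets_at_top
    using finite_subset_tuples_upto[of _ r] finite_tuples_upto[of r]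
    by (auto simp: eventually_sequentially tuples_upto_def)
  from filterlim_compose[OF lim this] show ?thesis
    by (simp add: elem_sym_def[abs_def])
qed

section \<open>Passage to the limit in the half-plane of absolute convergence\<close>

definition dirichlet_zeta :: "complex \<Rightarrow> complex" where
  "dirichlet_zeta s = (\<Sum>n. of_nat (Suc n) powr (- s))"

lemma norm_of_nat_powr: "norm (of_nat (Suc n) powr s :: complex) = real (Suc n) powr Re s"
  by (subst norm_powr_real_powr) auto

lemma summable_Suc_powr:
  assumes "a < -1"
  shows "summable (\<lambda>n. real (Suc n) powr a)"
  using assms by (subst summable_Suc_iff) (simp add: summable_real_powr_iff)

lemma summable_dirichlet_zeta:
  assumes "Re s > 1"
  shows "summable (\<lambda>n. of_nat (Suc n) powr (- s) :: complex)"
proof (rule summable_norm_cancel)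
  show "summable (\<lambda>n. norm (of_nat (Suc n) powr (- s) :: complex))"
    unfolding norm_of_nat_powr using assms by (intro summable_Suc_powr) auto
qed

lemma power_sum_tendsto_dirichlet_zeta:
  assumes "Re s > 1" "k \<ge> 1"
  shows "power_sum (\<lambda>m. of_nat m powr (- s)) k \<longlonglongrightarrow> dirichlet_zeta (of_nat k * s)"
proof -
  have "1 * 1 < real k * Re s"
    using assms by (intro mult_le_less_imp_less) auto
  then have "Re (of_nat k * s) > 1" by simp
  then have "(\<lambda>N. \<Sum>n<N. of_nat (Suc n) powr (- (of_nat k * s))) \<longlonglongrightarrow> dirichlet_zeta (of_nat k * s)"
    unfolding dirichlet_zeta_def by (intro summable_LIMSEQ summable_dirichlet_zeta)
  also have "(\<lambda>N. \<Sum>n<N. of_nat (Suc n) powr (- (of_nat k * s)))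
      = power_sum (\<lambda>m. of_nat m powr (- s)) k"
  proof
    fix N
    have "(\<Sum>n<N. of_nat (Suc n) powr (- (of_nat k * s))) = (\<Sum>n<N. (of_nat (Suc n) powr (- s)) ^ k)"
      by (intro sum.cong refl) (simp add: powr_def exp_of_nat_mult [symmetric] mult_ac of_nat_neq_0 del: of_nat_Suc)
    also have "\<dots> = power_sum (\<lambda>m. of_nat m powr (- s)) k N"
      unfolding power_sum_def by (rule sum.reindex_bij_witness[of _ "\<lambda>i. i - 1" Suc]) auto
    finally show "(\<Sum>n<N. of_nat (Suc n) powr (- (of_nat k * s)))
        = power_sum (\<lambda>m. of_nat m powr (- s)) k N" .
  qed
  finally show ?thesis .
qed

lemma elem_sym_tendsto_multizeta_series:
  assumes "Re s > 1"
  shows "elem_sym (\<lambda>m. of_nat m powr (- s)) r \<longlonglongrightarrow> multizeta_series r s"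
proof -
  have "summable (\<lambda>m. norm (of_nat m powr (- s) :: complex))"
    by (rule summable_Suc_iff [THEN iffD1], unfold norm_of_nat_powr)
       (use assms in \<open>intro summable_Suc_powr, simp\<close>)
  then have "elem_sym (\<lambda>m. of_nat m powr (- s)) r \<longlonglongrightarrow>
      (\<Sum>\<^sub>\<infinity>ms\<in>increasing_tuples r. prod_list (map (\<lambda>m. of_nat m powr (- s)) ms))"
    by (rule elem_sym_tendsto_infsum)
  also have "(\<Sum>\<^sub>\<infinity>ms\<in>increasing_tuples r. prod_list (map (\<lambda>m. of_nat m powr (- s)) ms))
      = multizeta_series r s"
    unfolding multizeta_series_def
  proof (rule infsum_cong)
    fix ms
    show "prod_list (map (\<lambda>m. of_nat m powr (- s)) ms) = of_nat (prod_list ms) powr (- s :: complex)"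
      by (induction ms) (auto simp: powr_times_real_left)
  qed
  finally show ?thesis .
qed

lemma newton_identity_multizeta_series:
  assumes "Re s > 1"
  shows "of_nat (Suc r) * multizeta_series (Suc r) s =
    (\<Sum>k\<le>r. (-1) ^ k * dirichlet_zeta (of_nat (Suc k) * s) * multizeta_series (r - k) s)"
proof (rule LIMSEQ_unique)
  let ?x = "\<lambda>m. of_nat m powr (- s)"
  show "(\<lambda>N. of_nat (Suc r) * elem_sym ?x (Suc r) N) \<longlonglongrightarrow> of_nat (Suc r) * multizeta_series (Suc r) s"
    by (intro tendsto_intros elem_sym_tendsto_multizeta_series assms)
  show "(\<lambda>N. of_nat (Suc r) * elem_sym ?x (Suc r) N) \<longlonglongrightarrow>
     (\<Sum>k\<le>r. (-1) ^ k * dirichlet_zeta (of_nat (Suc k) * s) * multizeta_series (r - k) s)"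
    unfolding newton_identity_finite
    by (intro tendsto_intros elem_sym_tendsto_multizeta_series power_sum_tendsto_dirichlet_zeta assms) auto
qed

lemma multizeta_series_0 [simp]: "multizeta_series 0 s = 1"
proof -
  have "increasing_tuples 0 = {[]}" by (auto simp: increasing_tuples_def)
  then show ?thesis by (simp add: multizeta_series_def)
qed

section \<open>Continuation of the Riemann zeta function\<close>

text \<open>Two integrations by parts move the second derivative of x^(-s) onto the weight u (1 - u)
  and leave the error of the trapezoidal rule on [n, n + 1]. The factor s - 1 clears the denominator
  of the primitive of x^(-s), so that s = 1 is covered too.\<close>

lemma has_integral_trapezoid:
  fixes n :: nat and s :: complex
  assumes "n \<ge> 1"
  shows "((\<lambda>u. of_real (u * (1 - u)) * ((s - 1) * s * (s + 1) * of_real (real n + u) powr (- s - 2)))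
     has_integral ((s - 1) * (of_nat n powr (- s) + of_nat (Suc n) powr (- s))
        + 2 * (of_nat (Suc n) powr (1 - s) - of_nat n powr (1 - s)))) {0..1}"
proof -
  define H :: "real \<Rightarrow> complex" where
    "H = (\<lambda>u. - (of_real (u * (1 - u)) * ((s - 1) * s * of_real (real n + u) powr (- s - 1)))
        - of_real (1 - 2 * u) * ((s - 1) * of_real (real n + u) powr (- s))
        + 2 * of_real (real n + u) powr (1 - s))"
  have "((\<lambda>u. of_real (u * (1 - u)) * ((s - 1) * s * (s + 1) * of_real (real n + u) powr (- s - 2)))
     has_integral (H 1 - H 0)) {0..1}"
  proof (rule fundamental_theorem_of_calculus)
    fix u :: real assume u: "u \<in> {0..1}"
    define z :: complex where "z = of_real (real n + u)"
    have pos: "real n + u > 0" using assms u by auto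
    have nn: "z \<notin> \<real>\<^sub>\<le>\<^sub>0"
      using pos by (auto simp: z_def complex_nonpos_Reals_iff)
    then have nz: "z \<noteq> 0" by auto
    have D: "((\<lambda>v. of_real (real n + v) powr a) has_vector_derivative a * z powr (a - 1)) (at u within {0..1})" for a
    proof -
      have "((\<lambda>w. (of_nat n + w) powr a) has_field_derivative a * z powr (a - 1)) (at (of_real u))"
        using nn by (auto intro!: derivative_eq_intros simp: z_def)
      then have "((\<lambda>v. (of_nat n + of_real v) powr a) has_vector_derivative a * z powr (a - 1)) (at u)"
        by (rule has_vector_derivative_real_field)
      then show ?thesis by (simp add: has_vector_derivative_at_within)
    qed
    have e1: "z powr (- s - 1) = z * z powr (- s - 2)" "z powr (- s) = z ^ 2 * z powr (- s - 2)"
        "z powr (- s - 1 - 1) = z powr (- s - 2)" "z powr (1 - s - 1) = z powr (- s)"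
      using nz by (auto simp: powr_diff field_simps power2_eq_square)
    have Q: "((\<lambda>v. complex_of_real (v * (1 - v))) has_vector_derivative of_real (1 - 2 * u)) (at u within {0..1})"
      "((\<lambda>v. complex_of_real (1 - 2 * v)) has_vector_derivative of_real (- 2)) (at u within {0..1})"
      by (rule has_vector_derivative_of_real, (auto intro!: derivative_eq_intros simp: has_real_derivative_iff_has_vector_derivative [symmetric])[])+
    have "(H has_vector_derivative
        - (of_real (u * (1 - u)) * ((s - 1) * s * ((- s - 1) * z powr (- s - 1 - 1)))
            + of_real (1 - 2 * u) * ((s - 1) * s * z powr (- s - 1)))
         - (of_real (1 - 2 * u) * ((s - 1) * ((- s) * z powr (- s - 1))) + of_real (- 2) * ((s - 1) * z powr (- s)))
         + 2 * ((1 - s) * z powr (1 - s - 1))) (at u within {0..1})"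
      unfolding H_def z_def
      by (intro has_vector_derivative_add has_vector_derivative_diff has_vector_derivative_minus
          has_vector_derivative_mult has_vector_derivative_mult_right Q D [unfolded z_def])
    also have "- (of_real (u * (1 - u)) * ((s - 1) * s * ((- s - 1) * z powr (- s - 1 - 1)))
            + of_real (1 - 2 * u) * ((s - 1) * s * z powr (- s - 1)))
         - (of_real (1 - 2 * u) * ((s - 1) * ((- s) * z powr (- s - 1))) + of_real (- 2) * ((s - 1) * z powr (- s)))
         + 2 * ((1 - s) * z powr (1 - s - 1))
       = of_real (u * (1 - u)) * ((s - 1) * s * (s + 1) * z powr (- s - 2))"
      unfolding e1 by (simp add: algebra_simps)
    finally show "(H has_vector_derivative of_real (u * (1 - u)) *
       ((s - 1) * s * (s + 1) * of_real (real n + u) powr (- s - 2))) (at u within {0..1})"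
      by (simp only: z_def)
  qed simp
  also have "H 1 - H 0 = (s - 1) * (of_nat n powr (- s) + of_nat (Suc n) powr (- s))
        + 2 * (of_nat (Suc n) powr (1 - s) - of_nat n powr (1 - s))"
    by (simp add: H_def algebra_simps)
  finally show ?thesis .
qed

text \<open>Half the integral just computed: s - 1 times the trapezoidal mean of x^(-s) on
  [n, n + 1] minus its integral.\<close>

definition trapezoid_term :: "nat \<Rightarrow> complex \<Rightarrow> complex" where
  "trapezoid_term n s = (s - 1) / 2 * (of_nat n powr (- s) + of_nat (Suc n) powr (- s))
        + (of_nat (Suc n) powr (1 - s) - of_nat n powr (1 - s))"

text \<open>The weight is at most 1 and each of s - 1, s, s + 1 at most R + 1 in norm. The exponent
  - Re s - 2 is below -1 exactly for Re s > -1, which fixes the half-plane of the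
  continuation.\<close>

lemma norm_trapezoid_term_le:
  assumes "n \<ge> 1" "Re s > -1" "norm s \<le> R"
  shows "norm (trapezoid_term n s) \<le> (R + 1) ^ 3 * real n powr (- Re s - 2)"
proof -
  have R: "0 \<le> R" using assms(3) norm_ge_zero order_trans by blast
  have n2: "norm (s - 1) \<le> R + 1" "norm (s + 1) \<le> R + 1"
    using assms(3) norm_triangle_ineq4[of s 1] norm_triangle_ineq[of s 1] by auto
  have n3: "norm ((s - 1) * s * (s + 1)) \<le> (R + 1) ^ 3"
    unfolding norm_mult power3_eq_cube using n2 assms(3) R
    by (intro mult_mono) auto
  have "norm (2 * trapezoid_term n s) \<le> (R + 1) ^ 3 * real n powr (- Re s - 2) * measure lborel {0..1::real}"
  proof (rule has_integral_bound_real[where S = "{}"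
       and f = "\<lambda>u. of_real (u * (1 - u)) * ((s - 1) * s * (s + 1) * of_real (real n + u) powr (- s - 2))"])
    show "((\<lambda>u. of_real (u * (1 - u)) * ((s - 1) * s * (s + 1) * of_real (real n + u) powr (- s - 2)))
       has_integral 2 * trapezoid_term n s) {0..1}"
    proof -
      have "2 * trapezoid_term n s = (s - 1) * (of_nat n powr (- s) + of_nat (Suc n) powr (- s))
          + 2 * (of_nat (Suc n) powr (1 - s) - of_nat n powr (1 - s))"
        unfolding trapezoid_term_def by simp
      with has_integral_trapezoid[OF assms(1), of s] show ?thesis by (simp only:)
    qed
    fix u :: real assume "u \<in> {0..1} - {}"
    then have u: "0 \<le> u" "u \<le> 1" by auto
    have "norm (of_real (real n + u) powr (- s - 2) :: complex) = (real n + u) powr (- Re s - 2)"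
      using u assms by (subst norm_powr_real_powr) auto
    also have "\<dots> \<le> real n powr (- Re s - 2)"
      using u assms by (intro powr_mono2') auto
    finally have 1: "norm (of_real (real n + u) powr (- s - 2) :: complex) \<le> real n powr (- Re s - 2)" .
    have 2: "norm (of_real (u * (1 - u)) :: complex) \<le> 1"
      using u by (subst norm_of_real) (simp add: abs_mult mult_le_one)
    have "norm (of_real (u * (1 - u)) * ((s - 1) * s * (s + 1) * of_real (real n + u) powr (- s - 2)))
       = norm (of_real (u * (1 - u)) :: complex) * (norm ((s - 1) * s * (s + 1)) * norm (of_real (real n + u) powr (- s - 2) :: complex))"
      by (simp only: norm_mult)
    also have "\<dots> \<le> 1 * ((R + 1) ^ 3 * real n powr (- Re s - 2))"
      using 1 2 n3 R by (intro mult_mono) auto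
    finally show "norm (of_real (u * (1 - u)) * ((s - 1) * s * (s + 1) * of_real (real n + u) powr (- s - 2)))
       \<le> (R + 1) ^ 3 * real n powr (- Re s - 2)" by simp
  qed (use R in auto)
  then have "norm (trapezoid_term n s) * 2 \<le> (R + 1) ^ 3 * real n powr (- Re s - 2)"
    by (simp add: norm_mult)
  then show ?thesis
    using norm_ge_zero[of "trapezoid_term n s"] by linarith
qed

text \<open>Equal to \<open>(s - 1) \<zeta>(s)\<close>; the factor \<open>s - 1\<close> removes the pole from every term of the series.\<close>

definition euler_zeta :: "complex \<Rightarrow> complex" where
  "euler_zeta s = 1 + (s - 1) / 2 + (\<Sum>n. trapezoid_term (Suc n) s)"

lemma holomorphic_series:
  fixes f :: "nat \<Rightarrow> complex \<Rightarrow> complex"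
  assumes "open S" "\<And>n. f n holomorphic_on S"
    and "\<And>z. z \<in> S \<Longrightarrow> \<exists>d>0. \<exists>h. summable h \<and> cball z d \<subseteq> S \<and> (\<forall>n. \<forall>w\<in>cball z d. norm (f n w) \<le> h n)"
  shows "(\<lambda>z. \<Sum>n. f n z) holomorphic_on S"
proof (rule holomorphic_uniform_sequence[OF assms(1), where f = "\<lambda>N z. \<Sum>n<N. f n z"])
  show "(\<lambda>z. \<Sum>n<N. f n z) holomorphic_on S" for N
    by (intro holomorphic_on_sum assms(2))
  fix z assume "z \<in> S"
  from assms(3)[OF this] obtain d h
    where dh: "d > 0" "summable h" "cball z d \<subseteq> S" "\<forall>n. \<forall>w\<in>cball z d. norm (f n w) \<le> h n"
    by (elim exE conjE) (rule that)
  have "uniform_limit (cball z d) (\<lambda>N w. \<Sum>n<N. f n w) (\<lambda>w. \<Sum>n. f n w) sequentially"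
    by (rule Weierstrass_m_test[OF _ dh(2)]) (use dh(4) in simp)
  then show "\<exists>d>0. cball z d \<subseteq> S \<and> uniform_limit (cball z d) (\<lambda>N w. \<Sum>n<N. f n w) (\<lambda>w. \<Sum>n. f n w) sequentially"
    by (intro exI[of _ d] conjI dh)
qed

lemma holomorphic_euler_zeta: "euler_zeta holomorphic_on {s. Re s > -1}"
proof -
  have "(\<lambda>s. \<Sum>n. trapezoid_term (Suc n) s) holomorphic_on {s. Re s > -1}"
  proof (rule holomorphic_series)
    show "open {s. Re s > -1}" by (simp add: open_halfspace_Re_gt)
    show "trapezoid_term (Suc n) holomorphic_on {s. Re s > -1}" for n
      unfolding trapezoid_term_def [abs_def] by (intro holomorphic_intros) (auto simp: of_nat_neq_0 simp del: of_nat_Suc)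
    fix z :: complex assume z: "z \<in> {s. Re s > -1}"
    define d where "d = (Re z + 1) / 2"
    define R where "R = norm z + d"
    define h where "h = (\<lambda>n. (R + 1) ^ 3 * real (Suc n) powr (- 1 - d))"
    have d: "d > 0" using z by (auto simp: d_def)
    have wd: "Re w \<ge> d - 1 \<and> norm w \<le> R" if "w \<in> cball z d" for w
    proof -
      have "norm (z - w) \<le> d" using that by (simp add: dist_norm)
      moreover have "\<bar>Re (z - w)\<bar> \<le> norm (z - w)" by (rule abs_Re_le_cmod)
      ultimately have "Re w \<ge> Re z - d" by auto
      moreover have "norm w \<le> norm z + norm (z - w)"
        using norm_triangle_ineq4[of z "z - w"] by simp
      moreover have "Re z = 2 * d - 1" by (simp add: d_def field_simps)
      ultimately show ?thesis using \<open>norm (z - w) \<le> d\<close> unfolding R_def by linarith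
    qed
    have "summable h"
      unfolding h_def using d by (intro summable_mult summable_Suc_powr) auto
    moreover have "cball z d \<subseteq> {s. Re s > -1}"
    proof
      fix w assume "w \<in> cball z d"
      from wd[OF this] d show "w \<in> {s. Re s > -1}" by simp
    qed
    moreover have "norm (trapezoid_term (Suc n) w) \<le> h n" if "w \<in> cball z d" for n w
    proof -
      have "norm (trapezoid_term (Suc n) w) \<le> (R + 1) ^ 3 * real (Suc n) powr (- Re w - 2)"
        using wd[OF that] d by (intro norm_trapezoid_term_le) auto
      also have "\<dots> \<le> h n"
        unfolding h_def using wd[OF that] d by (intro mult_left_mono powr_mono) (auto simp: R_def)
      finally show ?thesis .
    qed
    ultimately show "\<exists>d>0. \<exists>h. summable h \<and> cball z d \<subseteq> {s. Re s > -1} \<and>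
        (\<forall>n. \<forall>w\<in>cball z d. norm (trapezoid_term (Suc n) w) \<le> h n)"
      by (intro exI[of _ d] exI[of _ h] conjI d allI ballI)
  qed
  then show ?thesis unfolding euler_zeta_def [abs_def] by (intro holomorphic_intros) auto
qed

lemma holomorphic_dirichlet_zeta: "dirichlet_zeta holomorphic_on {s. Re s > 1}"
  unfolding dirichlet_zeta_def [abs_def]
proof (rule holomorphic_series)
  show "open {s. Re s > 1}" by (simp add: open_halfspace_Re_gt)
  show "(\<lambda>s. of_nat (Suc n) powr (- s)) holomorphic_on {s. Re s > 1}" for n
    by (intro holomorphic_intros) (auto simp: of_nat_neq_0 simp del: of_nat_Suc)
  fix z :: complex assume z: "z \<in> {s. Re s > 1}"
  define d where "d = (Re z - 1) / 2"
  have d: "d > 0" using z by (auto simp: d_def)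
  have wd: "Re w \<ge> d + 1" if "w \<in> cball z d" for w
  proof -
    have "\<bar>Re (z - w)\<bar> \<le> norm (z - w)" by (rule abs_Re_le_cmod)
    moreover have "Re z = 2 * d + 1" by (simp add: d_def field_simps)
    ultimately show ?thesis using that by (simp add: dist_norm)
  qed
  have "summable (\<lambda>n. real (Suc n) powr (- 1 - d))"
    using d by (intro summable_Suc_powr) auto
  moreover have "cball z d \<subseteq> {s. Re s > 1}"
  proof
    fix w assume "w \<in> cball z d"
    from wd[OF this] d show "w \<in> {s. Re s > 1}" by simp
  qed
  moreover have "norm (of_nat (Suc n) powr (- w) :: complex) \<le> real (Suc n) powr (- 1 - d)"
    if "w \<in> cball z d" for n w
    unfolding norm_of_nat_powr using wd[OF that] by (intro powr_mono) auto
  ultimately show "\<exists>d>0. \<exists>h. summable h \<and> cball z d \<subseteq> {s. Re s > 1} \<and>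
      (\<forall>n. \<forall>w\<in>cball z d. norm (of_nat (Suc n) powr (- w) :: complex) \<le> h n)"
    by (intro exI[of _ d] exI[of _ "\<lambda>n. real (Suc n) powr (- 1 - d)"] conjI d allI ballI)
qed

text \<open>For Re s > 1 the series may be split: the means of neighbouring terms add up to zeta
  less half its first term, the powers n^(1 - s) telescope to -1, and the two leading terms of
  \<open>euler_zeta\<close> restore what is missing.\<close>

lemma euler_zeta_eq_dirichlet_zeta:
  assumes "Re s > 1"
  shows "euler_zeta s = (s - 1) * dirichlet_zeta s"
proof -
  let ?p = "\<lambda>n. of_nat (Suc n) powr (- s) :: complex"
  let ?q = "\<lambda>n. of_nat (Suc n) powr (1 - s) :: complex"
  have S: "summable ?p" by (rule summable_dirichlet_zeta) fact
  have S': "(\<lambda>n. ?p (Suc n)) sums (dirichlet_zeta s - 1)"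
    using sums_Suc_iff[of ?p "dirichlet_zeta s - 1"] S
    by (simp add: dirichlet_zeta_def summable_sums)
  have "?q \<longlonglongrightarrow> 0"
    by (rule tendsto_neg_powr_complex_of_nat) (use assms in \<open>auto simp: filterlim_Suc\<close>)
  then have T: "(\<lambda>n. ?q (Suc n) - ?q n) sums (0 - ?q 0)"
    by (rule telescope_sums)
  have "(\<lambda>n. (s - 1) / 2 * (?p n + ?p (Suc n)) + (?q (Suc n) - ?q n)) sums
     ((s - 1) / 2 * (dirichlet_zeta s + (dirichlet_zeta s - 1)) + (0 - ?q 0))"
    by (intro sums_add sums_mult T S') (use S in \<open>simp add: dirichlet_zeta_def summable_sums\<close>)
  then have "(\<lambda>n. trapezoid_term (Suc n) s) sums ((s - 1) * dirichlet_zeta s - (s - 1) / 2 - 1)"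
    by (simp add: trapezoid_term_def field_simps)
  then show ?thesis by (simp add: euler_zeta_def sums_iff)
qed

section \<open>Bounds on the positive real axis\<close>

definition real_zeta :: "real \<Rightarrow> real" where
  "real_zeta y = (\<Sum>n. real (Suc n) powr (- y))"

lemma dirichlet_zeta_of_real:
  assumes "y > 1"
  shows "dirichlet_zeta (of_real y) = of_real (real_zeta y)"
proof -
  have "summable (\<lambda>n. real (Suc n) powr (- y))" using assms by (intro summable_Suc_powr) auto
  then have "complex_of_real (\<Sum>n. real (Suc n) powr (- y)) = (\<Sum>n. of_real (real (Suc n) powr (- y)))"
    by (rule suminf_of_real)
  also have "\<dots> = dirichlet_zeta (of_real y)"
    unfolding dirichlet_zeta_def by (intro suminf_cong) (subst powr_of_real [symmetric], auto)
  finally show ?thesis by (simp add: real_zeta_def)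
qed

lemma real_zeta_ge_1:
  assumes "y > 1"
  shows "real_zeta y \<ge> 1"
proof -
  have "summable (\<lambda>n. real (Suc n) powr (- y))" using assms by (intro summable_Suc_powr) auto
  then have "(\<Sum>n<1. real (Suc n) powr (- y)) \<le> real_zeta y"
    unfolding real_zeta_def by (rule sum_le_suminf) auto
  then show ?thesis by simp
qed

lemma real_zeta_minus_1:
  assumes "y > 1"
  shows "(\<lambda>n. real (n + 2) powr (- y)) sums (real_zeta y - 1)"
proof -
  have "summable (\<lambda>n. real (Suc n) powr (- y))" using assms by (intro summable_Suc_powr) auto
  then have "(\<lambda>n. real (Suc n) powr (- y)) sums real_zeta y"
    unfolding real_zeta_def by (rule summable_sums)
  then show ?thesis
    using sums_Suc_iff[of "\<lambda>n. real (Suc n) powr (- y)" "real_zeta y - 1"] by (simp add: add_ac)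
qed

text \<open>For m >= 2, m^(-2) <= 1 / ((m - 1) m), which telescopes to 1.\<close>

lemma real_zeta_2_le: "real_zeta 2 \<le> 2"
proof -
  have "(\<lambda>n. (- 1 / real (Suc (Suc n))) - (- 1 / real (Suc n))) sums (0 - (- 1 / real (Suc 0)))"
    by (rule telescope_sums) real_asymp
  moreover have "real (n + 2) powr (- 2) \<le> (- 1 / real (Suc (Suc n))) - (- 1 / real (Suc n))" for n
  proof -
    have "real (n + 2) powr (- 2) = 1 / (real (n + 2) * real (n + 2))"
      by (simp add: powr_minus power2_eq_square divide_inverse)
    also have "\<dots> \<le> 1 / (real (n + 1) * real (n + 2))"
      by (intro divide_left_mono mult_right_mono mult_pos_pos) auto
    also have "\<dots> = (- 1 / real (Suc (Suc n))) - (- 1 / real (Suc n))"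
      by (simp add: divide_simps)
    finally show ?thesis .
  qed
  ultimately have "real_zeta 2 - 1 \<le> 0 - (- 1 / real (Suc 0))"
    by (intro sums_le[OF _ real_zeta_minus_1]) auto
  then show ?thesis by simp
qed

text \<open>For m >= 2, m^(-3) <= 1 / ((m - 1) m (m + 1)), which telescopes to 1/4. The square of
  5/4 is the constant 25/16 in the later estimates.\<close>

lemma real_zeta_le_5_4:
  assumes "y \<ge> 3"
  shows "real_zeta y \<le> 5 / 4"
proof -
  let ?f = "\<lambda>n. - 1 / (2 * real (Suc n) * real (Suc (Suc n)))"
  have "(\<lambda>n. ?f (Suc n) - ?f n) sums (0 - ?f 0)"
    by (rule telescope_sums) real_asymp
  moreover have "real (n + 2) powr (- y) \<le> ?f (Suc n) - ?f n" for n
  proof -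
    have "real (n + 2) powr (- y) \<le> real (n + 2) powr (- 3)"
      using assms by (intro powr_mono) auto
    also have "\<dots> = 1 / real (n + 2) ^ 3"
      by (simp add: powr_minus field_simps)
    also have "\<dots> \<le> 1 / (real (n + 1) * real (n + 2) * real (n + 3))"
    proof (rule divide_left_mono)
      show "real (n + 1) * real (n + 2) * real (n + 3) \<le> real (n + 2) ^ 3"
        by (simp add: power3_eq_cube algebra_simps)
      show "0 < real (n + 2) ^ 3 * (real (n + 1) * real (n + 2) * real (n + 3))"
        by (intro mult_pos_pos zero_less_power) auto
    qed simp
    also have "\<dots> = ?f (Suc n) - ?f n"
      by (simp add: divide_simps) (simp add: algebra_simps)
    finally show ?thesis .
  qed
  ultimately have "real_zeta y - 1 \<le> 0 - ?f 0"
    using assms by (intro sums_le[OF _ real_zeta_minus_1]) auto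
  then show ?thesis by simp
qed

text \<open>Taken from the complex function, so that holomorphy provides existence of the derivative
  and Cauchy's inequality its bound, without termwise differentiation.\<close>

definition real_zeta' :: "real \<Rightarrow> real" where
  "real_zeta' y = Re (deriv dirichlet_zeta (of_real y))"

lemma has_real_derivative_real_zeta:
  assumes "y > 1"
  shows "(real_zeta has_real_derivative real_zeta' y) (at y)"
proof -
  have "(dirichlet_zeta has_field_derivative deriv dirichlet_zeta (of_real y)) (at (of_real y))"
    by (rule holomorphic_derivI[OF holomorphic_dirichlet_zeta]) (use assms in \<open>auto simp: open_halfspace_Re_gt\<close>)
  then have "((\<lambda>x. dirichlet_zeta (of_real x)) has_vector_derivative deriv dirichlet_zeta (of_real y)) (at y)"
    by (rule has_vector_derivative_real_field)
  then have "((\<lambda>x. Re (dirichlet_zeta (of_real x))) has_real_derivative real_zeta' y) (at y)"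
    unfolding real_zeta'_def has_real_derivative_iff_has_vector_derivative
    by (rule bounded_linear.has_vector_derivative[OF bounded_linear_Re])
  then show ?thesis
  proof (rule has_field_derivative_transform_within_open)
    show "open {1::real<..}" "y \<in> {1<..}" using assms by auto
    show "Re (dirichlet_zeta (of_real x)) = real_zeta x" if "x \<in> {1<..}" for x
      using that by (simp add: dirichlet_zeta_of_real)
  qed
qed

lemma norm_dirichlet_zeta_minus_1_le:
  assumes "Re s \<ge> 2"
  shows "norm (dirichlet_zeta s - 1) \<le> 1"
proof -
  have S: "(\<lambda>n. of_nat (Suc n) powr (- s) :: complex) sums dirichlet_zeta s"
    unfolding dirichlet_zeta_def by (intro summable_sums summable_dirichlet_zeta) (use assms in auto)
  then have S1: "(\<lambda>n. of_nat (Suc (Suc n)) powr (- s) :: complex) sums (dirichlet_zeta s - 1)"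
    using sums_Suc_iff[of "\<lambda>n. of_nat (Suc n) powr (- s) :: complex" "dirichlet_zeta s - 1"] by simp
  have "norm (\<Sum>n. of_nat (Suc (Suc n)) powr (- s) :: complex) \<le> (\<Sum>n. real (n + 2) powr (- 2))"
  proof (rule norm_suminf_le)
    show "norm (of_nat (Suc (Suc n)) powr (- s) :: complex) \<le> real (n + 2) powr (- 2)" for n
      unfolding norm_of_nat_powr using assms by (simp add: add_ac)
    show "summable (\<lambda>n. real (n + 2) powr (- 2))"
      using real_zeta_minus_1[of 2] by (simp add: sums_iff)
  qed
  then show ?thesis
    using S1 real_zeta_minus_1[of 2] real_zeta_2_le by (simp add: sums_iff)
qed

text \<open>Cauchy's inequality on the unit circle about \<open>y\<close>: it lies in Re s >= 2,
  where zeta differs from 1 by at most zeta(2) - 1 <= 1.\<close>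

lemma abs_real_zeta'_le:
  assumes "y \<ge> 3"
  shows "\<bar>real_zeta' y\<bar> \<le> 1"
proof -
  let ?f = "\<lambda>s. dirichlet_zeta s - 1"
  have re: "Re s \<ge> 2" if "s \<in> cball (of_real y) 1" for s
  proof -
    have "\<bar>Re (of_real y - s)\<bar> \<le> norm (of_real y - s)" by (rule abs_Re_le_cmod)
    then show ?thesis using that assms by (simp add: dist_norm)
  qed
  have hol: "?f holomorphic_on cball (of_real y) 1"
  proof (rule holomorphic_on_subset[of _ "{s. Re s > 1}"])
    show "cball (of_real y) 1 \<subseteq> {s. Re s > 1}" using re by fastforce
  qed (intro holomorphic_intros holomorphic_dirichlet_zeta)
  have "norm ((deriv ^^ 1) ?f (of_real y)) \<le> fact 1 * 1 / 1 ^ 1"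
  proof (rule Cauchy_inequality)
    show "?f holomorphic_on ball (of_real y) 1"
      using hol by (rule holomorphic_on_subset) auto
    show "continuous_on (cball (of_real y) 1) ?f"
      using hol by (rule holomorphic_on_imp_continuous_on)
    show "norm (?f s) \<le> 1" if "norm (of_real y - s) = 1" for s
      by (rule norm_dirichlet_zeta_minus_1_le, rule re) (simp add: dist_norm that)
  qed auto
  moreover have "deriv ?f (of_real y) = deriv dirichlet_zeta (of_real y)"
  proof -
    have "dirichlet_zeta field_differentiable (at (of_real y))"
      by (rule holomorphic_on_imp_differentiable_at[OF holomorphic_dirichlet_zeta])
         (use assms in \<open>auto simp: open_halfspace_Re_gt\<close>)
    then show ?thesis by (subst deriv_diff) auto
  qed
  ultimately have "norm (deriv dirichlet_zeta (of_real y)) \<le> 1" by simp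
  then show ?thesis
    unfolding real_zeta'_def using abs_Re_le_cmod order_trans by blast
qed

text \<open>By the mean value theorem the increment ln y of \<open>ln_Gamma\<close> over [y, y + 1]
  is a value of \<open>Digamma\<close> in between, and \<open>Digamma\<close> is increasing.\<close>

lemma Digamma_le_ln:
  assumes "(y::real) > 0"
  shows "Digamma y \<le> ln y" "ln y \<le> Digamma (y + 1)"
proof -
  have "\<exists>z>y. z < y + 1 \<and> ln_Gamma (y + 1) - ln_Gamma y = (y + 1 - y) * Digamma z"
    by (rule MVT2) (use assms in \<open>auto intro!: derivative_eq_intros\<close>)
  then obtain z where z: "z > y" "z < y + 1" "ln_Gamma (y + 1) - ln_Gamma y = Digamma z"
    by auto
  have "Gamma (y + 1) = y * Gamma y" using assms by (intro Gamma_plus1) (auto elim!: nonpos_Ints_cases)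
  moreover have "Gamma y > 0" using assms by simp
  ultimately have "ln_Gamma (y + 1) - ln_Gamma y = ln y"
    using assms by (simp add: ln_Gamma_real_pos ln_mult del: Gamma_real_pos)
  moreover have "Digamma y \<le> Digamma z" "Digamma z \<le> Digamma (y + 1)"
    using z assms by (auto intro!: Digamma_real_mono)
  ultimately show "Digamma y \<le> ln y" "ln y \<le> Digamma (y + 1)" using z by auto
qed

section \<open>Partial fractions of the hyperbolic cotangent\<close>

text \<open>Both sides of the reflection formula for \<open>Gamma\<close> are differentiated; the
  common nonzero factor pi / sin(pi z) cancels.\<close>

lemma Digamma_reflection:
  fixes z :: complex
  assumes "z \<notin> \<int>"
  shows "Digamma (1 - z) - Digamma z = of_real pi * cot (of_real pi * z)"
proof -
  have z: "z \<notin> \<int>\<^sub>\<le>\<^sub>0" "1 - z \<notin> \<int>\<^sub>\<le>\<^sub>0"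
    using assms nonpos_Ints_Int by (blast, metis Ints_1 Ints_diff diff_diff_eq2 diff_add_cancel add_diff_cancel_left' nonpos_Ints_Int)
  have s: "sin (of_real pi * z) \<noteq> 0"
    using assms by (auto simp: sin_eq_0 mult.commute)
  have G: "Gamma z * Gamma (1 - z) = of_real pi / sin (of_real pi * z)"
    by (rule Gamma_reflection_complex)
  have "((\<lambda>w. Gamma w * Gamma (1 - w)) has_field_derivative
      Gamma z * Gamma (1 - z) * (Digamma z - Digamma (1 - z))) (at z)"
    using z by (auto intro!: derivative_eq_intros simp: algebra_simps)
  then have "((\<lambda>w. of_real pi / sin (of_real pi * w)) has_field_derivative
      of_real pi / sin (of_real pi * z) * (Digamma z - Digamma (1 - z))) (at z)"
    unfolding Gamma_reflection_complex .
  moreover have "((\<lambda>w. of_real pi / sin (of_real pi * w)) has_field_derivative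
      - (of_real pi / sin (of_real pi * z) * (of_real pi * cot (of_real pi * z)))) (at z)"
    using s by (auto intro!: derivative_eq_intros simp: cot_def field_simps)
  ultimately have "of_real pi / sin (of_real pi * z) * (Digamma z - Digamma (1 - z))
      = - (of_real pi / sin (of_real pi * z) * (of_real pi * cot (of_real pi * z)))"
    by (rule DERIV_unique)
  then have "of_real pi / sin (of_real pi * z) * (Digamma z - Digamma (1 - z))
      = of_real pi / sin (of_real pi * z) * - (of_real pi * cot (of_real pi * z))"
    by simp
  then have "Digamma z - Digamma (1 - z) = - (of_real pi * cot (of_real pi * z))"
    using s by (subst (asm) mult_left_cancel) auto
  then show ?thesis by (simp add: algebra_simps)
qed

text \<open>This is cot(i pi y) = -i coth(pi y), expressed through exp(-2 pi y) so that it will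
  match the sum of a geometric series.\<close>

lemma cot_pi_i:
  fixes y :: real
  assumes "y > 0"
  shows "cot (of_real pi * (\<i> * of_real y)) = - \<i> * of_real ((1 + exp (- (2 * pi * y))) / (1 - exp (- (2 * pi * y))))"
proof -
  define E where "E = complex_of_real (exp (pi * y))"
  define F where "F = complex_of_real (exp (- (pi * y)))"
  have EF: "E * F = 1" unfolding E_def F_def of_real_mult [symmetric] exp_add [symmetric] by simp
  have F2: "complex_of_real (exp (- (2 * pi * y))) = F * F"
    unfolding F_def of_real_mult [symmetric] exp_add [symmetric] by simp
  have eE: "exp (- (\<i> * (of_real pi * (\<i> * of_real y)))) = E" "exp (\<i> * (of_real pi * (\<i> * of_real y))) = F"
  proof -
    have "- (\<i> * (of_real pi * (\<i> * of_real y))) = complex_of_real (pi * y)"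
      "\<i> * (of_real pi * (\<i> * of_real y)) = complex_of_real (- (pi * y))"
      by (simp_all add: complex_eq_iff)
    then show "exp (- (\<i> * (of_real pi * (\<i> * of_real y)))) = E" "exp (\<i> * (of_real pi * (\<i> * of_real y))) = F"
      by (simp_all only: E_def F_def exp_of_real)
  qed
  have ne: "E - F \<noteq> 0"
    unfolding E_def F_def of_real_diff [symmetric] using assms by (simp add: mult_pos_pos)
  have E0: "E \<noteq> 0" by (simp add: E_def)
  have "cot (of_real pi * (\<i> * of_real y)) = (F + E) / 2 / ((F - E) / (2 * \<i>))"
    unfolding cot_def sin_exp_eq cos_exp_eq eE ..
  also have "\<dots> = \<i> * ((F + E) / (F - E))"
    by (simp only: divide_divide_eq_right) simp
  also have "(F + E) / (F - E) = - ((E + F) / (E - F))"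
    using minus_divide_divide[of "E + F" "F - E"] by (simp add: minus_divide_right add.commute)
  also have "\<i> * - ((E + F) / (E - F)) = - \<i> * ((E + F) / (E - F))" by simp
  also have "(E + F) / (E - F) = (1 + F * F) / (1 - F * F)"
  proof -
    have "E * (1 + F * F) = E + (E * F) * F" "E * (1 - F * F) = E - (E * F) * F"
      by (simp_all only: distrib_left right_diff_distrib mult.assoc mult_1_right)
    then have "E + F = E * (1 + F * F)" "E - F = E * (1 - F * F)" by (simp_all only: EF mult_1_left)
    then show ?thesis using E0 by simp
  qed
  finally show ?thesis by (simp add: F2)
qed

text \<open>At z = i y the reflection formula for \<open>Digamma\<close> has coth on one side. On
  the other, the imaginary parts of 1 / (z + k) and 1 / (1 - z + k) are, up to sign, neighbouring
  members of one sequence, so the series is twice the sum of that sequence less its first member 1 /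
  y.\<close>

lemma coth_sums:
  fixes y :: real
  assumes y: "y > 0"
  shows "(\<lambda>k. 2 * y / (real (Suc k) ^ 2 + y ^ 2)) sums
     (pi * ((1 + exp (- (2 * pi * y))) / (1 - exp (- (2 * pi * y)))) - 1 / y)"
proof -
  define B where "B = (\<lambda>k. y / (real k ^ 2 + y ^ 2))"
  define z where "z = \<i> * complex_of_real y"
  define C where "C = (1 + exp (- (2 * pi * y))) / (1 - exp (- (2 * pi * y)))"
  have zi: "z \<notin> \<int>"
    using y by (auto simp: z_def Ints_def complex_eq_iff)
  then have z0: "z \<noteq> 0" "1 - z \<noteq> 0" by auto
  have S: "(\<lambda>k. inverse (z + of_nat k) - inverse (1 - z + of_nat k)) sums (Digamma (1 - z) - Digamma z)"
    using sums_diff[OF summable_sums[OF summable_Digamma[OF z0(2)]] summable_sums[OF summable_Digamma[OF z0(1)]]]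
    by (simp add: Digamma_def)
  have "Digamma (1 - z) - Digamma z = of_real pi * (- \<i> * of_real C)"
    using Digamma_reflection[OF zi] cot_pi_i[OF y] by (simp only: z_def C_def)
  then have "(\<lambda>k. - Im (inverse (z + of_nat k) - inverse (1 - z + of_nat k))) sums (pi * C)"
    using sums_minus[OF sums_Im[OF S]] by simp
  also have "(\<lambda>k. - Im (inverse (z + of_nat k) - inverse (1 - z + of_nat k))) = (\<lambda>k. B (Suc k) + B k)"
    by (rule ext) (simp add: B_def z_def add_ac)
  finally have BB: "(\<lambda>k. B (Suc k) + B k) sums (pi * C)" .
  have B0: "B k \<ge> 0" for k using y by (simp add: B_def)
  have sB: "summable B"
    by (rule summable_comparison_test'[OF sums_summable[OF BB], of 0]) (use B0 in auto)
  then have "(\<lambda>k. B (Suc k)) sums (suminf B - B 0)"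
    using sums_Suc_iff[of B "suminf B - B 0"] by (simp add: summable_sums)
  from sums_add[OF this summable_sums[OF sB]] BB have "pi * C = 2 * suminf B - B 0"
    by (auto dest: sums_unique2)
  moreover have "(\<lambda>k. 2 * B (Suc k)) sums (2 * (suminf B - B 0))"
    by (intro sums_mult) fact
  moreover have "B 0 = 1 / y" using y by (simp add: B_def power2_eq_square)
  ultimately have "(\<lambda>k. 2 * B (Suc k)) sums (pi * C - 1 / y)" by simp
  then show ?thesis by (simp add: B_def C_def)
qed

text \<open>The value is coth(t / 2) - 2 / t; it comes from y = t / (2 pi) after division by
  pi.\<close>

lemma coth_half_sums:
  fixes t :: real
  assumes t: "t > 0"
  shows "(\<lambda>k. 4 * t / (t ^ 2 + (2 * pi * real (Suc k)) ^ 2)) sums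
     ((1 + exp (- t)) / (1 - exp (- t)) - 2 / t)"
proof -
  have "(\<lambda>k. 1 / pi * (2 * (t / (2 * pi)) / (real (Suc k) ^ 2 + (t / (2 * pi)) ^ 2))) sums
     (1 / pi * (pi * ((1 + exp (- t)) / (1 - exp (- t))) - 1 / (t / (2 * pi))))"
    using sums_mult[OF coth_sums[of "t / (2 * pi)"], of "1 / pi"] t by simp
  also have "1 / pi * (pi * ((1 + exp (- t)) / (1 - exp (- t))) - 1 / (t / (2 * pi)))
      = (1 + exp (- t)) / (1 - exp (- t)) - 2 / t"
    using t by (simp add: right_diff_distrib)
  also have "(\<lambda>k. 1 / pi * (2 * (t / (2 * pi)) / (real (Suc k) ^ 2 + (t / (2 * pi)) ^ 2)))
      = (\<lambda>k. 4 * t / (t ^ 2 + (2 * pi * real (Suc k)) ^ 2))"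
  proof
    fix k
    define m where "m = real (Suc k)"
    have "m \<noteq> 0" by (simp add: m_def)
    moreover have "t ^ 2 + (2 * pi * m) ^ 2 > 0" "m ^ 2 + (t / (2 * pi)) ^ 2 > 0"
      using t \<open>m \<noteq> 0\<close> by (auto intro!: add_pos_nonneg)
    ultimately have "1 / pi * (2 * (t / (2 * pi)) / (m ^ 2 + (t / (2 * pi)) ^ 2))
      = 4 * t / (t ^ 2 + (2 * pi * m) ^ 2)"
      by (simp add: divide_simps) (simp add: power2_eq_square field_simps)
    then show "1 / pi * (2 * (t / (2 * pi)) / (real (Suc k) ^ 2 + (t / (2 * pi)) ^ 2))
      = 4 * t / (t ^ 2 + (2 * pi * real (Suc k)) ^ 2)"
      by (simp only: m_def)
  qed
  finally show ?thesis .
qed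

section \<open>Mellin integrals\<close>

text \<open>The Gamma integral rescaled by y. It is stated, like the integrals built on it, in the
  extended nonnegative reals, where orders of integration can be exchanged without integrability
  conditions.\<close>

lemma nn_integral_Gamma_scaled:
  fixes p y :: real
  assumes p: "p > 0" and y: "y > 0"
  shows "(\<integral>\<^sup>+t\<in>{0<..}. ennreal (t powr (p - 1) * exp (- (y * t))) \<partial>lborel) = ennreal (Gamma p * y powr (- p))"
proof -
  have "ennreal (Gamma p) = (\<integral>\<^sup>+t. ennreal (indicator {0..} t * t powr (p - 1) / exp t) \<partial>lborel)"
    by (rule Gamma_conv_nn_integral_real) fact
  also have "\<dots> = ennreal \<bar>y\<bar> * (\<integral>\<^sup>+t. ennreal (indicator {0..} (0 + y * t) * (0 + y * t) powr (p - 1) / exp (0 + y * t)) \<partial>lborel)"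
    by (rule nn_integral_real_affine) (use y in auto)
  also have "(\<integral>\<^sup>+t. ennreal (indicator {0..} (0 + y * t) * (0 + y * t) powr (p - 1) / exp (0 + y * t)) \<partial>lborel)
     = (\<integral>\<^sup>+t. ennreal (y powr (p - 1)) * (ennreal (t powr (p - 1) * exp (- (y * t))) * indicator {0<..} t) \<partial>lborel)"
  proof (rule nn_integral_cong)
    fix t :: real
    show "ennreal (indicator {0..} (0 + y * t) * (0 + y * t) powr (p - 1) / exp (0 + y * t))
      = ennreal (y powr (p - 1)) * (ennreal (t powr (p - 1) * exp (- (y * t))) * indicator {0<..} t)"
      using y by (cases "t > 0"; cases "t = 0")
        (auto simp: indicator_def powr_mult exp_minus field_simps zero_le_mult_iff simp flip: ennreal_mult)
  qed
  also have "\<dots> = ennreal (y powr (p - 1)) * (\<integral>\<^sup>+t\<in>{0<..}. ennreal (t powr (p - 1) * exp (- (y * t))) \<partial>lborel)"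
    by (rule nn_integral_cmult) measurable
  finally have *: "ennreal (Gamma p) = ennreal (y powr p) * (\<integral>\<^sup>+t\<in>{0<..}. ennreal (t powr (p - 1) * exp (- (y * t))) \<partial>lborel)"
    using y by (simp add: mult.assoc [symmetric] powr_diff flip: ennreal_mult)
  have "ennreal (Gamma p * y powr (- p)) = ennreal (y powr (- p)) * ennreal (Gamma p)"
    using p by (subst ennreal_mult [symmetric]) (auto simp: mult.commute)
  also have "\<dots> = ennreal (y powr (- p)) * ennreal (y powr p) * (\<integral>\<^sup>+t\<in>{0<..}. ennreal (t powr (p - 1) * exp (- (y * t))) \<partial>lborel)"
    unfolding * by (simp only: mult.assoc)
  also have "ennreal (y powr (- p)) * ennreal (y powr p) = 1"
    using y by (subst ennreal_mult [symmetric]) (auto simp flip: powr_add)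
  finally show ?thesis by simp
qed

lemma nn_integral_exp:
  fixes y :: real
  assumes y: "y > 0"
  shows "(\<integral>\<^sup>+t\<in>{0<..}. ennreal (exp (- (y * t))) \<partial>lborel) = ennreal (1 / y)"
proof -
  have "(\<integral>\<^sup>+t\<in>{0<..}. ennreal (exp (- (y * t))) \<partial>lborel)
     = (\<integral>\<^sup>+t\<in>{0<..}. ennreal (t powr (1 - 1) * exp (- (y * t))) \<partial>lborel)"
    by (intro nn_integral_cong) (auto simp: indicator_def)
  also have "\<dots> = ennreal (1 / y)"
    using nn_integral_Gamma_scaled[of 1 y] y by (simp add: powr_minus divide_inverse)
  finally show ?thesis .
qed

text \<open>Substitution on the compact intervals [0, n], then monotone convergence on both
  sides.\<close>

lemma nn_integral_power2_substitution:
  fixes f :: "real \<Rightarrow> real"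
  assumes [measurable]: "f \<in> borel_measurable borel" and f: "\<And>x. f x \<ge> 0"
  shows "(\<integral>\<^sup>+x\<in>{0..}. ennreal (f x) \<partial>lborel) = (\<integral>\<^sup>+x\<in>{0..}. ennreal (f (x ^ 2) * (2 * x)) \<partial>lborel)"
proof (rule LIMSEQ_unique)
  have eq: "(\<integral>\<^sup>+x\<in>{0..real n ^ 2}. ennreal (f x) \<partial>lborel)
    = (\<integral>\<^sup>+x\<in>{0..real n}. ennreal (f (x ^ 2) * (2 * x)) \<partial>lborel)" for n
  proof -
    have "(\<integral>\<^sup>+x. ennreal (f x * indicator {0 ^ 2..real n ^ 2} x) \<partial>lborel)
        = (\<integral>\<^sup>+x. ennreal (f (x ^ 2) * (2 * x) * indicator {0..real n} x) \<partial>lborel)"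
      by (rule nn_integral_substitution)
         (auto intro!: derivative_eq_intros continuous_intros simp: set_borel_measurable_def)
    then show ?thesis by (simp add: nn_integral_set_ennreal)
  qed
  show "(\<lambda>n. \<integral>\<^sup>+x\<in>{0..real n ^ 2}. ennreal (f x) \<partial>lborel) \<longlonglongrightarrow> (\<integral>\<^sup>+x\<in>{0..}. ennreal (f x) \<partial>lborel)"
  proof (rule nn_integral_LIMSEQ)
    show "incseq (\<lambda>n x. ennreal (f x) * indicator {0..real n ^ 2} x)"
    proof (intro incseq_SucI le_funI)
      fix n x
      have "real n ^ 2 \<le> real (Suc n) ^ 2" by (intro power_mono) auto
      then have "{0..real n ^ 2} \<subseteq> {0..real (Suc n) ^ 2}" by (simp only: atLeastatMost_subset_iff) simp
      then have "indicator {0..real n ^ 2} x \<le> (indicator {0..real (Suc n) ^ 2} x :: ennreal)"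
        by (intro indicator_leI) blast
      then show "ennreal (f x) * indicator {0..real n ^ 2} x \<le> ennreal (f x) * indicator {0..real (Suc n) ^ 2} x"
        by (rule mult_left_mono) simp
    qed
    fix x :: real
    show "(\<lambda>n. ennreal (f x) * indicator {0..real n ^ 2} x) \<longlonglongrightarrow> ennreal (f x) * indicator {0..} x"
    proof (rule tendsto_eventually)
      have "filterlim (\<lambda>n. real n ^ 2) at_top sequentially" by real_asymp
      then have "\<forall>\<^sub>F n in sequentially. real n ^ 2 \<ge> x" by (simp add: filterlim_at_top)
      then show "\<forall>\<^sub>F n in sequentially. ennreal (f x) * indicator {0..real n ^ 2} x = ennreal (f x) * indicator {0..} x"
        by eventually_elim (auto simp: indicator_def)
    qed
  qed measurable
  show "(\<lambda>n. \<integral>\<^sup>+x\<in>{0..real n ^ 2}. ennreal (f x) \<partial>lborel) \<longlonglongrightarrow> (\<integral>\<^sup>+x\<in>{0..}. ennreal (f (x ^ 2) * (2 * x)) \<partial>lborel)"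
    unfolding eq
  proof (rule nn_integral_LIMSEQ)
    show "incseq (\<lambda>n x. ennreal (f (x ^ 2) * (2 * x)) * indicator {0..real n} x)"
      by (intro incseq_SucI le_funI mult_left_mono) (auto simp: indicator_def)
    fix x :: real
    show "(\<lambda>n. ennreal (f (x ^ 2) * (2 * x)) * indicator {0..real n} x) \<longlonglongrightarrow> ennreal (f (x ^ 2) * (2 * x)) * indicator {0..} x"
    proof (rule tendsto_eventually)
      have "filterlim (\<lambda>n. real n) at_top sequentially" by real_asymp
      then have "\<forall>\<^sub>F n in sequentially. real n \<ge> x" by (simp add: filterlim_at_top)
      then show "\<forall>\<^sub>F n in sequentially. ennreal (f (x ^ 2) * (2 * x)) * indicator {0..real n} x = ennreal (f (x ^ 2) * (2 * x)) * indicator {0..} x"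
        by eventually_elim (auto simp: indicator_def)
    qed
  qed measurable
qed

lemma Gamma_reflection_real:
  fixes x :: real
  shows "Gamma x * Gamma (1 - x) = pi / sin (pi * x)"
proof -
  have "complex_of_real (Gamma x * Gamma (1 - x)) = of_real (pi / sin (pi * x))"
    using Gamma_reflection_complex[of "of_real x"]
    by (simp flip: Gamma_complex_of_real sin_of_real)
  then show ?thesis by (simp only: of_real_eq_iff)
qed

text \<open>With x = t^2 and 1 / (x + b^2) written as the integral of exp(-(x + b^2) v), exchanging
  the integrals leaves two of Gamma type, with values Gamma p and Gamma (1 - p) for p = (1 - a) / 2.
  The reflection formula makes their product pi / cos(pi a / 2).\<close>

lemma nn_integral_powr_over_quadratic:
  fixes a b :: real
  assumes a: "0 < a" "a < 1" and b: "b > 0"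
  shows "(\<integral>\<^sup>+t\<in>{0<..}. ennreal (t powr (- a) / (t ^ 2 + b ^ 2)) \<partial>lborel)
     = ennreal (pi / (2 * cos (pi * a / 2)) * b powr (- a - 1))"
proof -
  define p where "p = (1 - a) / 2"
  have p: "0 < p" "0 < 1 - p" using a by (auto simp: p_def)
  \<comment> \<open>The absolute value keeps \<open>f\<close> nonnegative on the whole line, as the
    substitution rule demands.\<close>
  define f where "f = (\<lambda>x. x powr (p - 1) / (2 * (\<bar>x\<bar> + b ^ 2)))"
  have [measurable]: "f \<in> borel_measurable borel" unfolding f_def by measurable
  have "(\<integral>\<^sup>+t\<in>{0<..}. ennreal (t powr (- a) / (t ^ 2 + b ^ 2)) \<partial>lborel)
      = (\<integral>\<^sup>+t\<in>{0..}. ennreal (f (t ^ 2) * (2 * t)) \<partial>lborel)"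
  proof (rule nn_integral_cong)
    fix t :: real
    have "f (t ^ 2) * (2 * t) = t powr (- a) / (t ^ 2 + b ^ 2)" if "t > 0"
    proof -
      have "(t ^ 2) powr (p - 1) * t = t powr (2 * (p - 1)) * t powr 1"
        using that by (simp add: powr_powr flip: powr_numeral)
      also have "\<dots> = t powr (- a)" unfolding powr_add [symmetric] by (simp add: p_def field_simps)
      finally have e: "(t ^ 2) powr (p - 1) * t = t powr (- a)" .
      define X where "X = t ^ 2 + b ^ 2"
      have "f (t ^ 2) * (2 * t) = (t ^ 2) powr (p - 1) * t / X"
        unfolding f_def by (simp flip: X_def)
      then show ?thesis by (simp only: e X_def)
    qed
    then show "ennreal (t powr (- a) / (t ^ 2 + b ^ 2)) * indicator {0<..} t
       = ennreal (f (t ^ 2) * (2 * t)) * indicator {0..} t"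
      by (cases "t > 0"; cases "t = 0") (auto simp: indicator_def)
  qed
  also have "\<dots> = (\<integral>\<^sup>+x\<in>{0..}. ennreal (f x) \<partial>lborel)"
    by (rule nn_integral_power2_substitution [symmetric]) (auto simp: f_def)
  also have "\<dots> = (\<integral>\<^sup>+x. (\<integral>\<^sup>+v. ennreal (1 / 2 * x powr (p - 1) * exp (- ((x + b ^ 2) * v))) * indicator {0<..} x * indicator {0<..} v \<partial>lborel) \<partial>lborel)"
  proof (rule nn_integral_cong)
    fix x :: real
    have "(\<integral>\<^sup>+v. ennreal (1 / 2 * x powr (p - 1) * exp (- ((x + b ^ 2) * v))) * indicator {0<..} x * indicator {0<..} v \<partial>lborel)
        = (\<integral>\<^sup>+v. (ennreal (1 / 2 * x powr (p - 1)) * indicator {0<..} x) * (ennreal (exp (- ((x + b ^ 2) * v))) * indicator {0<..} v) \<partial>lborel)"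
      by (intro nn_integral_cong) (auto simp: indicator_def simp flip: ennreal_mult)
    also have "\<dots> = (ennreal (1 / 2 * x powr (p - 1)) * indicator {0<..} x) * (\<integral>\<^sup>+v\<in>{0<..}. ennreal (exp (- ((x + b ^ 2) * v))) \<partial>lborel)"
      by (rule nn_integral_cmult) measurable
    also have "\<dots> = ennreal (f x) * indicator {0..} x"
    proof (cases "x > 0")
      case True
      then have "x + b ^ 2 > 0" by (simp add: add_pos_nonneg)
      then show ?thesis using True
        by (subst nn_integral_exp) (auto simp: f_def indicator_def simp flip: ennreal_mult)
    qed (auto simp: indicator_def f_def)
    finally show "ennreal (f x) * indicator {0..} x =
      (\<integral>\<^sup>+v. ennreal (1 / 2 * x powr (p - 1) * exp (- ((x + b ^ 2) * v))) * indicator {0<..} x * indicator {0<..} v \<partial>lborel)" ..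
  qed
  also have "\<dots> = (\<integral>\<^sup>+v. (\<integral>\<^sup>+x. ennreal (1 / 2 * x powr (p - 1) * exp (- ((x + b ^ 2) * v))) * indicator {0<..} x * indicator {0<..} v \<partial>lborel) \<partial>lborel)"
    by (rule lborel_pair.Fubini') measurable
  also have "\<dots> = (\<integral>\<^sup>+v. ennreal (1 / 2 * Gamma p) * (ennreal (v powr ((1 - p) - 1) * exp (- (b ^ 2 * v))) * indicator {0<..} v) \<partial>lborel)"
  proof (rule nn_integral_cong)
    fix v :: real
    have "(\<integral>\<^sup>+x. ennreal (1 / 2 * x powr (p - 1) * exp (- ((x + b ^ 2) * v))) * indicator {0<..} x * indicator {0<..} v \<partial>lborel)
       = (\<integral>\<^sup>+x. (ennreal (1 / 2 * exp (- (b ^ 2 * v))) * indicator {0<..} v) * (ennreal (x powr (p - 1) * exp (- (v * x))) * indicator {0<..} x) \<partial>lborel)"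
    proof (rule nn_integral_cong)
      fix x :: real
      have "exp (- ((x + b ^ 2) * v)) = exp (- (b ^ 2 * v)) * exp (- (v * x))"
        unfolding exp_add [symmetric] by (simp add: algebra_simps)
      then show "ennreal (1 / 2 * x powr (p - 1) * exp (- ((x + b ^ 2) * v))) * indicator {0<..} x * indicator {0<..} v
        = (ennreal (1 / 2 * exp (- (b ^ 2 * v))) * indicator {0<..} v) * (ennreal (x powr (p - 1) * exp (- (v * x))) * indicator {0<..} x)"
        by (simp add: indicator_def mult_ac flip: ennreal_mult)
    qed
    also have "\<dots> = (ennreal (1 / 2 * exp (- (b ^ 2 * v))) * indicator {0<..} v) * (\<integral>\<^sup>+x\<in>{0<..}. ennreal (x powr (p - 1) * exp (- (v * x))) \<partial>lborel)"
      by (rule nn_integral_cmult) measurable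
    also have "\<dots> = ennreal (1 / 2 * Gamma p) * (ennreal (v powr ((1 - p) - 1) * exp (- (b ^ 2 * v))) * indicator {0<..} v)"
    proof (cases "v > 0")
      case True
      then show ?thesis using p
        by (subst nn_integral_Gamma_scaled) (auto simp: indicator_def mult_ac simp flip: ennreal_mult)
    qed (auto simp: indicator_def)
    finally show "(\<integral>\<^sup>+x. ennreal (1 / 2 * x powr (p - 1) * exp (- ((x + b ^ 2) * v))) * indicator {0<..} x * indicator {0<..} v \<partial>lborel)
      = ennreal (1 / 2 * Gamma p) * (ennreal (v powr ((1 - p) - 1) * exp (- (b ^ 2 * v))) * indicator {0<..} v)" .
  qed
  also have "\<dots> = ennreal (1 / 2 * Gamma p) * (\<integral>\<^sup>+v\<in>{0<..}. ennreal (v powr ((1 - p) - 1) * exp (- (b ^ 2 * v))) \<partial>lborel)"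
    by (rule nn_integral_cmult) measurable
  also have "\<dots> = ennreal (1 / 2 * Gamma p) * ennreal (Gamma (1 - p) * (b ^ 2) powr (- (1 - p)))"
    using p b by (subst nn_integral_Gamma_scaled) auto
  also have "\<dots> = ennreal (1 / 2 * (Gamma p * Gamma (1 - p)) * (b ^ 2) powr (- (1 - p)))"
    using p by (simp add: mult_ac flip: ennreal_mult)
  also have "(b ^ 2) powr (- (1 - p)) = b powr (- a - 1)"
  proof -
    have "(b ^ 2) powr (- (1 - p)) = b powr (2 * - (1 - p))"
      using b by (simp add: powr_powr flip: powr_numeral)
    also have "2 * - (1 - p) = - a - 1" by (simp add: p_def field_simps)
    finally show ?thesis .
  qed
  also have "Gamma p * Gamma (1 - p) = pi / cos (pi * a / 2)"
  proof -
    have "sin (pi * p) = cos (pi * a / 2)"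
      by (simp add: p_def cos_sin_eq right_diff_distrib diff_divide_distrib)
    then show ?thesis by (simp add: Gamma_reflection_real)
  qed
  finally show ?thesis by simp
qed

section \<open>The functional equation\<close>

text \<open>The Laplace transform of the trapezoid kernel on one interval. Multiplied by the
  geometric sum 1 / (1 - exp (- t)) it becomes (coth(t / 2) - 2 / t) / t^2, whose partial fractions
  are known.\<close>

lemma has_integral_exp_weight:
  fixes t :: real
  assumes t: "t > 0"
  shows "((\<lambda>u. u * (1 - u) * exp (- (t * u))) has_integral
     ((1 + exp (- t)) / t ^ 2 - 2 * (1 - exp (- t)) / t ^ 3)) {0..1}"
proof -
  define r where "r = 1 / t"
  have tr: "t * r = 1" using t by (simp add: r_def)
  define F where "F = (\<lambda>u. exp (- (t * u)) * (- (u * (1 - u) * r) - (1 - 2 * u) * r ^ 2 + 2 * r ^ 3))"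
  have "((\<lambda>u. u * (1 - u) * exp (- (t * u))) has_integral (F 1 - F 0)) {0..1}"
  proof (rule fundamental_theorem_of_calculus)
    fix u :: real
    have "(F has_real_derivative
        exp (- (t * u)) * (- t) * (- (u * (1 - u) * r) - (1 - 2 * u) * r ^ 2 + 2 * r ^ 3)
        + exp (- (t * u)) * (- ((1 - 2 * u) * r) + 2 * r ^ 2)) (at u within {0..1})"
      unfolding F_def by (auto intro!: derivative_eq_intros simp: algebra_simps)
    also have "exp (- (t * u)) * (- t) * (- (u * (1 - u) * r) - (1 - 2 * u) * r ^ 2 + 2 * r ^ 3)
        + exp (- (t * u)) * (- ((1 - 2 * u) * r) + 2 * r ^ 2)
        = exp (- (t * u)) * ((t * r) * (u * (1 - u) + (1 - 2 * u) * r - 2 * r ^ 2) - (1 - 2 * u) * r + 2 * r ^ 2)"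
      by (simp add: algebra_simps power2_eq_square power3_eq_cube)
    also have "\<dots> = u * (1 - u) * exp (- (t * u))"
      unfolding tr by simp
    finally show "(F has_vector_derivative u * (1 - u) * exp (- (t * u))) (at u within {0..1})"
      by (simp add: has_real_derivative_iff_has_vector_derivative)
  qed simp
  also have "F 1 - F 0 = (1 + exp (- t)) / t ^ 2 - 2 * (1 - exp (- t)) / t ^ 3"
    using t by (simp add: F_def r_def field_simps)
  finally show ?thesis .
qed

context
  fixes a :: real
  assumes a: "0 < a" "a < 1"
begin

lemma cos_half_pos: "cos (pi * a / 2) > 0"
proof -
  have "0 < pi * a" "pi * a < pi" using a by simp_all
  then show ?thesis by (intro cos_gt_zero_pi; linarith)
qed

text \<open>Twice the trapezoid term at s = -a divided by (s - 1) s (s + 1), that is, the kernel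
  integrated against (n + u)^(a - 2). The interval n = 0, whose integrand is singular at 0, is added
  by hand: it starts the geometric series at exponent 0, and its value cancels the two leading terms
  of \<open>euler_zeta\<close>.\<close>

definition trapezoid_error :: "nat \<Rightarrow> real" where
  "trapezoid_error n = (if n = 0 then 1 / (a * (a + 1))
      else Re (2 * trapezoid_term n (of_real (- a))) / (a * (a + 1) * (1 - a)))"

lemma trapezoid_error_has_integral:
  "((\<lambda>u. u * (1 - u) * (real n + u) powr (a - 2)) has_integral trapezoid_error n) {0..1}"
proof (cases "n = 0")
  case True
  have "((\<lambda>u. u powr (a - 1) - u powr a) has_integral
      (1 powr (a - 1 + 1) / (a - 1 + 1) - 1 powr (a + 1) / (a + 1))) {0..1}"
    by (intro has_integral_diff has_integral_powr_from_0) (use a in auto)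
  also have "1 powr (a - 1 + 1) / (a - 1 + 1) - 1 powr (a + 1) / (a + 1) = trapezoid_error n"
    using a True by (simp add: trapezoid_error_def field_simps)
  finally show ?thesis
  proof (rule has_integral_eq [rotated])
    fix u :: real assume "u \<in> {0..1}"
    show "u powr (a - 1) - u powr a = u * (1 - u) * (real n + u) powr (a - 2)"
    proof (cases "u = 0")
      case False
      then have "u > 0" using \<open>u \<in> {0..1}\<close> by simp
      then have "u powr (a - 1) = u powr (a - 2) * u powr 1" "u powr a = u powr (a - 2) * u powr 2"
        unfolding powr_add [symmetric] by simp_all
      then show ?thesis using True \<open>u > 0\<close> by (simp add: algebra_simps power2_eq_square)
    qed auto
  qed
next
  case False
  define c where "c = a * (a + 1) * (1 - a)"
  have c: "c > 0" using a by (simp add: c_def)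
  have "2 * trapezoid_term n (of_real (- a)) = (of_real (- a) - 1) * (of_nat n powr (- of_real (- a)) + of_nat (Suc n) powr (- of_real (- a)))
          + 2 * (of_nat (Suc n) powr (1 - of_real (- a)) - of_nat n powr (1 - of_real (- a)))"
    unfolding trapezoid_term_def by simp
  then have I: "((\<lambda>u. of_real (u * (1 - u)) * ((of_real (- a) - 1) * of_real (- a) * (of_real (- a) + 1) *
       complex_of_real (real n + u) powr (- of_real (- a) - 2))) has_integral 2 * trapezoid_term n (of_real (- a))) {0..1}"
    using has_integral_trapezoid[of n "of_real (- a)"] False by simp
  have R: "Re (2 * trapezoid_term n (of_real (- a))) = c * trapezoid_error n"
    using False c by (simp add: trapezoid_error_def flip: c_def)
  have "((\<lambda>u. Re (of_real (u * (1 - u)) * ((of_real (- a) - 1) * of_real (- a) * (of_real (- a) + 1) *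
       complex_of_real (real n + u) powr (- of_real (- a) - 2)))) has_integral c * trapezoid_error n) {0..1}"
    using has_integral_linear[OF I bounded_linear_Re] unfolding o_def R .
  then have "((\<lambda>u. c * (u * (1 - u) * (real n + u) powr (a - 2))) has_integral c * trapezoid_error n) {0..1}"
  proof (rule has_integral_eq [rotated])
    fix u :: real assume u: "u \<in> {0..1}"
    have "complex_of_real (real n + u) powr (- of_real (- a) - 2) = of_real ((real n + u) powr (a - 2))"
      using u by (subst powr_of_real [symmetric]) auto
    then have "of_real (u * (1 - u)) * ((of_real (- a) - 1) * of_real (- a) * (of_real (- a) + 1) *
       complex_of_real (real n + u) powr (- of_real (- a) - 2)) = of_real (c * (u * (1 - u) * (real n + u) powr (a - 2)))"
      by (simp add: c_def algebra_simps)
    then show "Re (of_real (u * (1 - u)) * ((of_real (- a) - 1) * of_real (- a) * (of_real (- a) + 1) *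
       complex_of_real (real n + u) powr (- of_real (- a) - 2))) = c * (u * (1 - u) * (real n + u) powr (a - 2))"
      by (simp only: Re_complex_of_real)
  qed
  from has_integral_mult_right[OF this, of "1 / c"] show ?thesis using c by simp
qed

text \<open>The term is real at s = -a, so the real part taken in \<open>trapezoid_error\<close>
  loses nothing.\<close>

lemma trapezoid_term_of_real_error:
  "trapezoid_term (Suc n) (of_real (- a)) = of_real (a * (a + 1) * (1 - a) / 2 * trapezoid_error (Suc n))"
proof -
  have "trapezoid_term (Suc n) (of_real (- a)) = of_real
     ((- a - 1) / 2 * (real (Suc n) powr a + real (Suc (Suc n)) powr a)
        + (real (Suc (Suc n)) powr (1 + a) - real (Suc n) powr (1 + a)))"
    unfolding trapezoid_term_def
    by (simp add: powr_of_real [symmetric] del: of_nat_Suc) 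
  then have "trapezoid_term (Suc n) (of_real (- a)) = of_real (Re (trapezoid_term (Suc n) (of_real (- a))))"
    by (simp only: Re_complex_of_real)
  then show ?thesis using a by (simp add: trapezoid_error_def)
qed

lemma trapezoid_error_nonneg: "trapezoid_error n \<ge> 0"
  by (rule has_integral_nonneg[OF trapezoid_error_has_integral]) auto

text \<open>The power (n + u)^(a - 2) is replaced by its Gamma integral over t. After the exchange,
  the integral over u is the Laplace transform of the kernel.\<close>

lemma Gamma_trapezoid_error:
  "ennreal (Gamma (2 - a) * trapezoid_error n) =
    (\<integral>\<^sup>+t\<in>{0<..}. ennreal (t powr (1 - a) * exp (- t) ^ n *
        ((1 + exp (- t)) / t ^ 2 - 2 * (1 - exp (- t)) / t ^ 3)) \<partial>lborel)"
proof -
  let ?h = "\<lambda>u t. ennreal (u * (1 - u) * (t powr (1 - a) * exp (- ((real n + u) * t)))) * indicator {0..1} u * indicator {0<..} t"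
  have "ennreal (Gamma (2 - a) * trapezoid_error n) = ennreal (Gamma (2 - a)) * ennreal (trapezoid_error n)"
    using a trapezoid_error_nonneg by (intro ennreal_mult) auto
  also have "ennreal (trapezoid_error n) = (\<integral>\<^sup>+u\<in>{0..1}. ennreal (u * (1 - u) * (real n + u) powr (a - 2)) \<partial>lborel)"
    by (rule nn_integral_has_integral_lebesgue' [symmetric, OF _ trapezoid_error_has_integral]) auto
  also have "ennreal (Gamma (2 - a)) * \<dots> =
      (\<integral>\<^sup>+u. ennreal (Gamma (2 - a)) * (ennreal (u * (1 - u) * (real n + u) powr (a - 2)) * indicator {0..1} u) \<partial>lborel)"
    by (rule nn_integral_cmult [symmetric]) measurable
  also have "\<dots> = (\<integral>\<^sup>+u. (\<integral>\<^sup>+t. ?h u t \<partial>lborel) \<partial>lborel)"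
  proof (rule nn_integral_cong)
    fix u :: real
    show "ennreal (Gamma (2 - a)) * (ennreal (u * (1 - u) * (real n + u) powr (a - 2)) * indicator {0..1} u)
       = (\<integral>\<^sup>+t. ?h u t \<partial>lborel)"
    \<comment> \<open>At u = 0 the Gamma integral diverges when n = 0, but the kernel u (1 - u)
      makes both sides 0.\<close>
    proof (cases "0 < u \<and> u \<le> 1")
      case True
      have "(\<integral>\<^sup>+t. ?h u t \<partial>lborel) = (\<integral>\<^sup>+t. ennreal (u * (1 - u)) *
          (ennreal (t powr ((2 - a) - 1) * exp (- ((real n + u) * t))) * indicator {0<..} t) \<partial>lborel)"
        using True by (intro nn_integral_cong) (auto simp: indicator_def simp flip: ennreal_mult)
      also have "\<dots> = ennreal (u * (1 - u)) *
          (\<integral>\<^sup>+t\<in>{0<..}. ennreal (t powr ((2 - a) - 1) * exp (- ((real n + u) * t))) \<partial>lborel)"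
        by (rule nn_integral_cmult) measurable
      also have "\<dots> = ennreal (u * (1 - u)) * ennreal (Gamma (2 - a) * (real n + u) powr (- (2 - a)))"
        using True a by (subst nn_integral_Gamma_scaled) auto
      also have "\<dots> = ennreal (Gamma (2 - a)) * (ennreal (u * (1 - u) * (real n + u) powr (a - 2)) * indicator {0..1} u)"
        using True a by (simp add: mult_ac flip: ennreal_mult)
      finally show ?thesis ..
    next
      case False
      then have "u = 0 \<or> u \<notin> {0..1}" by auto
      then show ?thesis by auto
    qed
  qed
  also have "\<dots> = (\<integral>\<^sup>+t. (\<integral>\<^sup>+u. ?h u t \<partial>lborel) \<partial>lborel)"
    by (rule lborel_pair.Fubini' [symmetric]) measurable
  also have "\<dots> = (\<integral>\<^sup>+t\<in>{0<..}. ennreal (t powr (1 - a) * exp (- t) ^ n *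
        ((1 + exp (- t)) / t ^ 2 - 2 * (1 - exp (- t)) / t ^ 3)) \<partial>lborel)"
  proof (rule nn_integral_cong)
    fix t :: real
    show "(\<integral>\<^sup>+u. ?h u t \<partial>lborel) = ennreal (t powr (1 - a) * exp (- t) ^ n *
        ((1 + exp (- t)) / t ^ 2 - 2 * (1 - exp (- t)) / t ^ 3)) * indicator {0<..} t"
    proof (cases "t > 0")
      case True
      have "(\<integral>\<^sup>+u. ?h u t \<partial>lborel) = (\<integral>\<^sup>+u. ennreal (t powr (1 - a) * exp (- t) ^ n) *
          (ennreal (u * (1 - u) * exp (- (t * u))) * indicator {0..1} u) \<partial>lborel)"
      proof (rule nn_integral_cong)
        fix u :: real
        have "exp (- ((real n + u) * t)) = exp (- t) ^ n * exp (- (t * u))"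
          unfolding exp_of_nat_mult [symmetric] exp_add [symmetric] by (simp add: algebra_simps)
        then show "?h u t = ennreal (t powr (1 - a) * exp (- t) ^ n) *
          (ennreal (u * (1 - u) * exp (- (t * u))) * indicator {0..1} u)"
          using True by (auto simp: indicator_def mult_ac simp flip: ennreal_mult)
      qed
      also have "\<dots> = ennreal (t powr (1 - a) * exp (- t) ^ n) *
         (\<integral>\<^sup>+u\<in>{0..1}. ennreal (u * (1 - u) * exp (- (t * u))) \<partial>lborel)"
        by (rule nn_integral_cmult) measurable
      also have "(\<integral>\<^sup>+u\<in>{0..1}. ennreal (u * (1 - u) * exp (- (t * u))) \<partial>lborel)
          = ennreal ((1 + exp (- t)) / t ^ 2 - 2 * (1 - exp (- t)) / t ^ 3)"
        by (rule nn_integral_has_integral_lebesgue' [OF _ has_integral_exp_weight[OF True]]) auto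
      also have "ennreal (t powr (1 - a) * exp (- t) ^ n) * \<dots> = ennreal (t powr (1 - a) * exp (- t) ^ n *
        ((1 + exp (- t)) / t ^ 2 - 2 * (1 - exp (- t)) / t ^ 3))"
        by (rule ennreal_mult' [symmetric]) simp
      finally show ?thesis using True by simp
    qed auto
  qed
  finally show ?thesis .
qed

lemma exp_weight_nonneg:
  fixes t :: real
  assumes "t > 0"
  shows "(1 + exp (- t)) / t ^ 2 - 2 * (1 - exp (- t)) / t ^ 3 \<ge> 0"
  by (rule has_integral_nonneg[OF has_integral_exp_weight[OF assms]]) auto

text \<open>For k >= 1 the k-th partial fraction has its poles at distance 2 pi k from 0, so its
  Mellin integral is a constant times (2 pi k)^(-a - 1). Summing over k is what produces zeta at the
  reflected argument 1 + a.\<close>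

lemma suminf_Gamma_trapezoid_error:
  "(\<Sum>n. ennreal (Gamma (2 - a) * trapezoid_error n)) =
     ennreal (2 * pi / cos (pi * a / 2) * (2 * pi) powr (- a - 1) * real_zeta (a + 1))"
proof -
  let ?w = "\<lambda>t::real. (1 + exp (- t)) / t ^ 2 - 2 * (1 - exp (- t)) / t ^ 3"
  let ?g = "\<lambda>k t. t powr (- a) / (t ^ 2 + (2 * pi * real (Suc k)) ^ 2)"
  define C where "C = cos (pi * a / 2)"
  have C: "C > 0" unfolding C_def by (rule cos_half_pos)
  have "(\<Sum>n. ennreal (Gamma (2 - a) * trapezoid_error n)) =
     (\<Sum>n. \<integral>\<^sup>+t\<in>{0<..}. ennreal (t powr (1 - a) * exp (- t) ^ n * ?w t) \<partial>lborel)"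
    by (simp only: Gamma_trapezoid_error)
  also have "\<dots> = (\<integral>\<^sup>+t. (\<Sum>n. ennreal (t powr (1 - a) * exp (- t) ^ n * ?w t) * indicator {0<..} t) \<partial>lborel)"
    by (rule nn_integral_suminf [symmetric]) measurable
  also have "\<dots> = (\<integral>\<^sup>+t. (\<Sum>k. ennreal (4 * ?g k t) * indicator {0<..} t) \<partial>lborel)"
  proof (rule nn_integral_cong)
    fix t :: real
    show "(\<Sum>n. ennreal (t powr (1 - a) * exp (- t) ^ n * ?w t) * indicator {0<..} t)
        = (\<Sum>k. ennreal (4 * ?g k t) * indicator {0<..} t)"
    proof (cases "t > 0")
      case True
      have e: "exp (- t) < 1" using True by simp
      have "(\<lambda>n. exp (- t) ^ n * (t powr (1 - a) * ?w t)) sums (1 / (1 - exp (- t)) * (t powr (1 - a) * ?w t))"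
        by (intro sums_mult2 geometric_sums) (use e in auto)
      then have 1: "(\<Sum>n. ennreal (t powr (1 - a) * exp (- t) ^ n * ?w t))
          = ennreal (1 / (1 - exp (- t)) * (t powr (1 - a) * ?w t))"
        using exp_weight_nonneg[OF True] by (intro suminf_ennreal_eq) (auto simp: mult_ac)
      have "(\<lambda>k. t powr (- a - 1) * (4 * t / (t ^ 2 + (2 * pi * real (Suc k)) ^ 2))) sums
          (t powr (- a - 1) * ((1 + exp (- t)) / (1 - exp (- t)) - 2 / t))"
        by (intro sums_mult coth_half_sums True)
      also have "(\<lambda>k. t powr (- a - 1) * (4 * t / (t ^ 2 + (2 * pi * real (Suc k)) ^ 2))) = (\<lambda>k. 4 * ?g k t)"
      proof
        fix k
        have "t powr (- a - 1) * t powr 1 = t powr (- a)" unfolding powr_add [symmetric] by simp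
        then have "t powr (- a - 1) * t = t powr (- a)" using True by simp
        then show "t powr (- a - 1) * (4 * t / (t ^ 2 + (2 * pi * real (Suc k)) ^ 2)) = 4 * ?g k t"
          by (simp add: mult.left_commute [of _ 4])
      qed
      also have "t powr (- a - 1) * ((1 + exp (- t)) / (1 - exp (- t)) - 2 / t)
          = 1 / (1 - exp (- t)) * (t powr (1 - a) * ?w t)"
      proof -
        have "t powr (1 - a) = t powr (- a - 1) * t powr 2" unfolding powr_add [symmetric] by simp
        then have q: "t powr (1 - a) = t powr (- a - 1) * t ^ 2" using True by simp
        have "t ^ 2 * (Y / t ^ 2 - 2 * X / t ^ 3) = Y - 2 * X / t" for X Y
          using True by (simp add: right_diff_distrib power2_eq_square power3_eq_cube)
        then have w: "(1 + exp (- t)) - 2 * (1 - exp (- t)) / t = t ^ 2 * ?w t" by (rule sym)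
        have "1 / (1 - exp (- t)) * (t powr (1 - a) * ?w t)
            = t powr (- a - 1) * (1 / (1 - exp (- t)) * ((1 + exp (- t)) - 2 * (1 - exp (- t)) / t))"
          unfolding q w by (simp only: mult_ac)
        also have "1 / (1 - exp (- t)) * ((1 + exp (- t)) - 2 * (1 - exp (- t)) / t)
            = (1 + exp (- t)) / (1 - exp (- t)) - 2 / t"
        proof -
          have *: "1 / X * (Y - 2 * X / t) = Y / X - 2 / t" if "X \<noteq> 0" for X Y
            using that by (simp add: right_diff_distrib)
          show ?thesis by (rule *) (use e in simp)
        qed
        finally show ?thesis ..
      qed
      finally have 2: "(\<Sum>k. ennreal (4 * ?g k t)) = ennreal (1 / (1 - exp (- t)) * (t powr (1 - a) * ?w t))"
        by (intro suminf_ennreal_eq) auto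
      show ?thesis using True 1 2 by simp
    qed auto
  qed
  also have "\<dots> = (\<Sum>k. \<integral>\<^sup>+t\<in>{0<..}. ennreal (4 * ?g k t) \<partial>lborel)"
    by (rule nn_integral_suminf) measurable
  also have "\<dots> = (\<Sum>k. ennreal (2 * pi / C * (2 * pi) powr (- a - 1) * real (Suc k) powr (- (a + 1))))"
  proof (rule suminf_cong)
    fix k
    have "(\<integral>\<^sup>+t\<in>{0<..}. ennreal (4 * ?g k t) \<partial>lborel) = (\<integral>\<^sup>+t. 4 * (ennreal (?g k t) * indicator {0<..} t) \<partial>lborel)"
    proof (rule nn_integral_cong)
      have "ennreal (4 * x) = 4 * ennreal x" for x by (simp add: ennreal_mult')
      then show "ennreal (4 * ?g k t) * indicator {0<..} t = 4 * (ennreal (?g k t) * indicator {0<..} t)" for t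
        by (simp only: mult.assoc)
    qed
    also have "\<dots> = 4 * (\<integral>\<^sup>+t\<in>{0<..}. ennreal (?g k t) \<partial>lborel)"
      by (rule nn_integral_cmult) measurable
    also have "\<dots> = ennreal 4 * ennreal (pi / (2 * C) * (2 * pi * real (Suc k)) powr (- a - 1))"
      unfolding C_def by (subst nn_integral_powr_over_quadratic) (use a in auto)
    also have "\<dots> = ennreal (4 * (pi / (2 * C) * (2 * pi * real (Suc k)) powr (- a - 1)))"
      by (rule ennreal_mult' [symmetric]) simp
    also have "4 * (pi / (2 * C) * (2 * pi * real (Suc k)) powr (- a - 1))
        = 2 * pi / C * (2 * pi) powr (- a - 1) * real (Suc k) powr (- (a + 1))"
      by (subst powr_mult) (auto simp del: of_nat_Suc)
    finally show "(\<integral>\<^sup>+t\<in>{0<..}. ennreal (4 * ?g k t) \<partial>lborel)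
        = ennreal (2 * pi / C * (2 * pi) powr (- a - 1) * real (Suc k) powr (- (a + 1)))" .
  qed
  also have "\<dots> = ennreal (2 * pi / C * (2 * pi) powr (- a - 1) * real_zeta (a + 1))"
  proof (rule suminf_ennreal_eq)
    have "summable (\<lambda>n. real (Suc n) powr (- (a + 1)))" using a by (intro summable_Suc_powr) auto
    then show "(\<lambda>k. 2 * pi / C * (2 * pi) powr (- a - 1) * real (Suc k) powr (- (a + 1))) sums
        (2 * pi / C * (2 * pi) powr (- a - 1) * real_zeta (a + 1))"
      unfolding real_zeta_def by (intro sums_mult summable_sums)
  qed (use C in auto)
  finally show ?thesis by (simp only: C_def)
qed

text \<open>The sum over all intervals leaves Gamma (2 - a) and cos(pi a / 2) in the denominator.
  The reflection formula at \<open>a\<close> and the double angle formula for sin(pi a) convert them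
  into Gamma (1 + a) and sin(pi a / 2) in the numerator.\<close>

lemma euler_zeta_functional_equation:
  "euler_zeta (of_real (- a)) = of_real ((a + 1) / pi * (2 * pi) powr (- a) * sin (pi * a / 2) * Gamma (1 + a) * real_zeta (1 + a))"
proof -
  define V where "V = 2 * pi / cos (pi * a / 2) * (2 * pi) powr (- a - 1) * real_zeta (a + 1)"
  define G where "G = Gamma (2 - a)"
  have G: "G > 0" using a by (simp add: G_def)
  note C = cos_half_pos
  have V: "V \<ge> 0" using C real_zeta_ge_1[of "a + 1"] a by (simp add: V_def)
  have E: "(\<Sum>n. ennreal (G * trapezoid_error n)) = ennreal V"
    unfolding G_def V_def by (rule suminf_Gamma_trapezoid_error)
  have nn: "G * trapezoid_error n \<ge> 0" for n using G trapezoid_error_nonneg by simp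
  have S: "summable (\<lambda>n. G * trapezoid_error n)"
    by (rule summable_suminf_not_top) (use nn E in auto)
  have "ennreal (\<Sum>n. G * trapezoid_error n) = ennreal V"
    using E suminf_ennreal[of "\<lambda>n. G * trapezoid_error n"] nn by simp
  then have "(\<Sum>n. G * trapezoid_error n) = V"
    using V S nn by (subst (asm) ennreal_inj) (auto intro!: suminf_nonneg)
  then have "(\<lambda>n. G * trapezoid_error n) sums V" using S by (simp add: sums_iff)
  from sums_mult[OF this, of "1 / G"] have T: "trapezoid_error sums (V / G)" using G by simp
  define c where "c = a * (a + 1) * (1 - a)"
  have "(\<lambda>n. trapezoid_error (Suc n)) sums (V / G - trapezoid_error 0)"
    using T by (simp add: sums_Suc_iff)
  then have "(\<lambda>n. complex_of_real (c / 2 * trapezoid_error (Suc n))) sums of_real (c / 2 * (V / G - trapezoid_error 0))"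
    by (intro sums_of_real sums_mult)
  then have "(\<Sum>n. trapezoid_term (Suc n) (of_real (- a))) = of_real (c / 2 * (V / G - trapezoid_error 0))"
    unfolding trapezoid_term_of_real_error c_def by (simp add: sums_iff)
  then have "euler_zeta (of_real (- a)) = of_real (1 + (- a - 1) / 2 + c / 2 * (V / G - trapezoid_error 0))"
    unfolding euler_zeta_def by simp
  also have "1 + (- a - 1) / 2 + c / 2 * (V / G - trapezoid_error 0) = c / 2 * (V / G)"
  proof -
    have "a \<noteq> 0" "a + 1 \<noteq> 0" using a by auto
    then have "c * trapezoid_error 0 = 1 - a"
      by (simp add: c_def trapezoid_error_def)
    moreover have "c / 2 * (V / G - trapezoid_error 0) = c / 2 * (V / G) - c * trapezoid_error 0 / 2"
      by (simp add: right_diff_distrib)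
    ultimately show ?thesis by (simp only:) (simp add: field_simps)
  qed
  also have "\<dots> = (a + 1) / pi * (2 * pi) powr (- a) * sin (pi * a / 2) * Gamma (1 + a) * real_zeta (1 + a)"
  proof -
    have G1: "G = (1 - a) * Gamma (1 - a)"
    proof -
      have "1 - a \<notin> \<int>\<^sub>\<le>\<^sub>0" using a by (auto elim!: nonpos_Ints_cases)
      then have "Gamma (1 - a + 1) = (1 - a) * Gamma (1 - a)" by (rule Gamma_plus1)
      then show ?thesis by (simp add: G_def)
    qed
    have Ga: "Gamma (1 + a) = a * Gamma a"
    proof -
      have "a \<notin> \<int>\<^sub>\<le>\<^sub>0" using a by (auto elim!: nonpos_Ints_cases)
      then have "Gamma (a + 1) = a * Gamma a" by (rule Gamma_plus1)
      then show ?thesis by (simp add: add.commute)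
    qed
    have s: "sin (pi * a) = 2 * sin (pi * a / 2) * cos (pi * a / 2)"
      using sin_double[of "pi * a / 2"] by simp
    have s0: "sin (pi * a / 2) > 0" using a by (intro sin_gt_zero) (auto simp: field_simps)
    have R: "Gamma a * Gamma (1 - a) * (2 * sin (pi * a / 2) * cos (pi * a / 2)) = pi"
      using Gamma_reflection_real[of a] s0 C by (simp add: s)
    have "Gamma (1 - a) > 0" using a by simp
    then have R': "1 / Gamma (1 - a) = Gamma a * (2 * sin (pi * a / 2) * cos (pi * a / 2)) / pi"
      using R by (simp add: field_simps)
    have P: "2 * pi * (2 * pi) powr (- a - 1) = (2 * pi) powr (- a)"
    proof -
      have "(2 * pi) powr 1 * (2 * pi) powr (- a - 1) = (2 * pi) powr (- a)"
        unfolding powr_add [symmetric] by simp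
      then show ?thesis by simp
    qed
    have "c / 2 * (V / G) = a * (a + 1) / 2 * (1 / Gamma (1 - a)) * ((2 * pi * (2 * pi) powr (- a - 1)) / cos (pi * a / 2) * real_zeta (a + 1))"
      using a by (simp add: c_def V_def G1)
    also have "\<dots> = a * (a + 1) / 2 * (Gamma a * (2 * sin (pi * a / 2) * cos (pi * a / 2)) / pi)
        * ((2 * pi) powr (- a) / cos (pi * a / 2) * real_zeta (a + 1))"
      unfolding P R' ..
    also have "\<dots> = (a + 1) / pi * (2 * pi) powr (- a) * sin (pi * a / 2) * Gamma (1 + a) * real_zeta (1 + a)"
      using C by (simp add: Ga add.commute)
    finally show ?thesis .
  qed
  finally show ?thesis .
qed

end

section \<open>Zeros of a perturbed sine\<close>

lemma cos_ge_half: "\<bar>d\<bar> \<le> pi / 3 \<Longrightarrow> cos d \<ge> 1 / 2"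
proof -
  assume "\<bar>d\<bar> \<le> pi / 3"
  then have "cos (pi / 3) \<le> cos \<bar>d\<bar>"
    by (intro cos_monotone_0_pi_le) auto
  then show ?thesis by (simp add: cos_60)
qed

text \<open>The half-width pi / 3 serves both estimates of the zero count: within it cos is at least
  1/2, and from there to pi / 2 the sine is at least sqrt 3 / 2, well above 1/4.\<close>

lemma abs_less_pi_third:
  assumes "\<bar>sin d\<bar> \<le> 1 / 4" "\<bar>d\<bar> \<le> pi / 2"
  shows "\<bar>d\<bar> < pi / 3"
proof (rule ccontr)
  assume "\<not> \<bar>d\<bar> < pi / 3"
  then have "sin (pi / 3) \<le> sin \<bar>d\<bar>"
    using assms(2) by (intro sin_monotone_2pi_le) auto
  moreover have "sin (pi / 3) \<ge> 1 / 2" by (simp add: sin_60)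
  ultimately have "sin \<bar>d\<bar> \<ge> 1 / 2" by linarith
  then show False using assms(1) by (auto simp: abs_if split: if_splits)
qed

lemma sin_plus_nat_pi: "sin (real i * pi + d) = (-1) ^ i * sin d"
  by (simp add: sin_add mult.commute)

lemma cos_plus_nat_pi: "cos (real i * pi + d) = (-1) ^ i * cos d"
  by (simp add: cos_add mult.commute)

text \<open>
  In the windows \<open>\<bar>x - i\<pi>\<bar> \<le> \<pi>/3\<close> the derivative of \<open>sin\<close> dominates \<open>q'\<close>; outside of them \<open>sin\<close>
  itself dominates \<open>q\<close>.
\<close>

lemma card_zeros_perturbed_sin:
  fixes q q' :: "real \<Rightarrow> real" and r :: nat
  assumes deriv: "\<And>x. 0 \<le> x \<Longrightarrow> x \<le> r * pi \<Longrightarrow> (q has_real_derivative q' x) (at x)"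
    and q': "\<And>x. 0 \<le> x \<Longrightarrow> x \<le> r * pi \<Longrightarrow> \<bar>q' x\<bar> < 1 / 2"
    and q: "\<And>x. 0 \<le> x \<Longrightarrow> x \<le> r * pi \<Longrightarrow> \<bar>q x\<bar> \<le> 1 / 4"
    and ends: "q 0 = 0" "q (r * pi) = 0"
  shows "finite {x. 0 < x \<and> x < r * pi \<and> sin x + q x = 0} \<and>
     card {x. 0 < x \<and> x < r * pi \<and> sin x + q x = 0} = r - 1"
proof -
  \<comment> \<open>The sign makes \<open>g i\<close> increase through the window around i pi,
    whatever the parity of \<open>i\<close>.\<close>
  define g where "g = (\<lambda>i x. (-1) ^ i * (sin x + q x))"
  have g0: "g i x = 0 \<longleftrightarrow> sin x + q x = 0" for i x by (simp add: g_def)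
  have dg: "(g i has_real_derivative (-1) ^ i * (cos x + q' x)) (at x)"
    if "0 \<le> x" "x \<le> r * pi" for i x
    unfolding g_def by (auto intro!: derivative_eq_intros deriv that)
  have mono: "g i x < g i y" if xy: "x < y" "0 \<le> x" "y \<le> r * pi"
      "\<bar>x - i * pi\<bar> \<le> pi / 3" "\<bar>y - i * pi\<bar> \<le> pi / 3" for i :: nat and x y
  proof (rule DERIV_pos_imp_increasing[OF xy(1)])
    fix z assume z: "x \<le> z" "z \<le> y"
    define d where "d = z - i * pi"
    have "\<bar>d\<bar> \<le> pi / 3" using z xy unfolding d_def by linarith
    then have "cos d \<ge> 1 / 2" by (rule cos_ge_half)
    moreover have "z = i * pi + d" by (simp add: d_def)
    then have "(-1) ^ i * cos z = cos d" by (simp add: cos_plus_nat_pi)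
    moreover have "\<bar>(-1) ^ i * q' z\<bar> < 1 / 2"
      using q'[of z] z xy by (simp add: abs_mult power_abs)
    ultimately have "(-1) ^ i * (cos z + q' z) > 0" by (simp add: distrib_left abs_less_iff)
    then show "\<exists>l. (g i has_real_derivative l) (at z) \<and> l > 0"
      using dg[of z i] z xy by auto
  qed
  define Z where "Z = {x. 0 < x \<and> x < r * pi \<and> sin x + q x = 0}"
  have near: "\<exists>i\<in>{1..<r}. \<bar>x - real i * pi\<bar> < pi / 3" if x: "x \<in> Z" for x
  proof -
    have x0: "0 < x" "x < r * pi" "sin x + q x = 0" using x by (auto simp: Z_def)
    \<comment> \<open>The index of the multiple of pi nearest to \<open>x\<close>.\<close>
    define i where "i = nat \<lfloor>x / pi + 1 / 2\<rfloor>"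
    define d where "d = x - real i * pi"
    have "real i = \<lfloor>x / pi + 1 / 2\<rfloor>" using x0 by (simp add: i_def)
    then have "real i \<le> x / pi + 1 / 2" "x / pi + 1 / 2 < real i + 1" by linarith+
    then have "real i * pi \<le> x + pi / 2" "x < real i * pi + pi / 2"
      by (auto simp: field_simps)
    then have d: "\<bar>d\<bar> \<le> pi / 2" unfolding d_def by linarith
    have xd: "x = real i * pi + d" by (simp add: d_def)
    have "\<bar>sin x\<bar> \<le> 1 / 4" using q[of x] x0 by (auto simp: abs_if split: if_splits)
    then have "\<bar>sin d\<bar> \<le> 1 / 4" unfolding xd sin_plus_nat_pi by (simp add: abs_mult power_abs)
    then have d3: "\<bar>d\<bar> < pi / 3" using abs_less_pi_third d by blast
    \<comment> \<open>The half windows at the two ends hold no interior zero: the function vanishes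
      at the end itself and is strictly monotone there.\<close>
    have i0: "i \<noteq> 0"
    proof
      assume "i = 0"
      then have "g 0 0 < g 0 x" using d3 x0 by (intro mono) (auto simp: d_def)
      then show False using x0 ends by (simp add: g_def)
    qed
    have ir: "i \<noteq> r"
    proof
      assume "i = r"
      then have "g r x < g r (r * pi)" using d3 x0 by (intro mono) (auto simp: d_def)
      then show False using x0 ends by (simp add: g_def)
    qed
    have "real i * pi < (real r + 1) * pi"
      using d3 x0 unfolding d_def distrib_right by linarith
    then have "i < r + 1" by (subst (asm) mult_less_cancel_right_pos) auto
    then show ?thesis using i0 ir d3 by (auto simp: d_def intro!: bexI[of _ i])
  qed
  have ex: "\<exists>x. x \<in> Z \<and> \<bar>x - real i * pi\<bar> < pi / 3" if i: "i \<in> {1..<r}" for i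
  proof -
    have "real i \<ge> 1" "real i + 1 \<le> r" using i by auto
    then have "real i * pi \<ge> 1 * pi" "(real i + 1) * pi \<le> r * pi"
      by (intro mult_right_mono; simp)+
    then have rng: "real i * pi - pi / 3 > 0" "real i * pi + pi / 3 < r * pi"
      using pi_gt_zero unfolding distrib_right by linarith+
    have s3: "sqrt 3 > 1" by simp
    have qb: "\<bar>(-1) ^ i * q x\<bar> \<le> 1 / 4" if "0 \<le> x" "x \<le> r * pi" for x
      using q[of x] that by (simp add: abs_mult power_abs)
    have v: "g i (real i * pi + d) = sin d + (-1) ^ i * q (real i * pi + d)" for d
      by (simp add: g_def sin_plus_nat_pi distrib_left)
    have e: "\<bar>(-1) ^ i * q (real i * pi - pi / 3)\<bar> \<le> 1 / 4" "\<bar>(-1) ^ i * q (real i * pi + pi / 3)\<bar> \<le> 1 / 4"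
      by (rule qb; use rng pi_gt_zero in linarith)+
    have "sin (pi / 3) > 1 / 2" by (simp add: sin_60)
    \<comment> \<open>At the edges of a window the sine exceeds 1/2 in absolute value while the
      perturbation is at most 1/4, hence a sign change.\<close>
    then have 1: "g i (real i * pi - pi / 3) < 0" and 2: "g i (real i * pi + pi / 3) > 0"
      using v[of "- (pi / 3)"] v[of "pi / 3"] e unfolding sin_minus abs_le_iff by simp_all
    have "continuous_on {real i * pi - pi / 3..real i * pi + pi / 3} (g i)"
      by (intro continuous_at_imp_continuous_on ballI DERIV_isCont[OF dg])
         (use rng in \<open>simp_all only: atLeastAtMost_iff, linarith+\<close>)
    then obtain x where x: "real i * pi - pi / 3 \<le> x" "x \<le> real i * pi + pi / 3" "g i x = 0"
      using IVT'[of "g i" "real i * pi - pi / 3" 0 "real i * pi + pi / 3"] 1 2 pi_gt_zero by fastforce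
    then have "x \<noteq> real i * pi - pi / 3" "x \<noteq> real i * pi + pi / 3" using 1 2 by auto
    then have "0 < x" "x < r * pi" "\<bar>x - real i * pi\<bar> < pi / 3"
      using x(1,2) rng by linarith+
    then show ?thesis using x(3) g0 by (intro exI[of _ x]) (auto simp: Z_def)
  qed
  then obtain z where z: "\<And>i. i \<in> {1..<r} \<Longrightarrow> z i \<in> Z \<and> \<bar>z i - real i * pi\<bar> < pi / 3" by metis
  have Z: "Z = z ` {1..<r}"
  proof (intro equalityI subsetI)
    fix x assume x: "x \<in> Z"
    then obtain i where i: "i \<in> {1..<r}" "\<bar>x - real i * pi\<bar> < pi / 3" using near by blast
    have zi: "z i \<in> Z" "\<bar>z i - real i * pi\<bar> < pi / 3" using z[OF i(1)] by auto
    have "g i x = g i (z i)" using x zi by (simp add: Z_def g_def)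
    then have "x = z i"
      using mono[of x "z i" i] mono[of "z i" x i] x zi i by (fastforce simp: Z_def)
    then show "x \<in> z ` {1..<r}" using i by auto
  qed (use z in auto)
  \<comment> \<open>The centres are pi apart and the windows have width 2 pi / 3, so they are
    disjoint.\<close>
  have "inj_on z {1..<r}"
  proof (rule linorder_inj_onI)
    fix i j :: nat assume ij: "i < j" "i \<in> {1..<r}" "j \<in> {1..<r}"
    have "real i + 1 \<le> real j" using ij by simp
    then have "(real i + 1) * pi \<le> real j * pi" by (intro mult_right_mono) auto
    moreover have "z i < real i * pi + pi / 3" "real j * pi - pi / 3 < z j"
      using z[OF ij(2)] z[OF ij(3)] unfolding abs_less_iff by linarith+
    ultimately have "z i < z j" using pi_gt_zero unfolding distrib_right by linarith
    then show "z i \<noteq> z j" by simp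
  qed auto
  then show ?thesis
    unfolding Z_def [symmetric] using Z by (simp add: card_image)
qed

section \<open>Ratios of Mellin transforms\<close>

text \<open>For y > 0 this is the integral of t^y / (exp t - 1) over t > 0, a Mellin
  transform.\<close>

definition mellin :: "real \<Rightarrow> real" where
  "mellin y = Gamma (y + 1) * real_zeta (y + 1)"

definition mellin_ratio :: "nat \<Rightarrow> nat \<Rightarrow> real \<Rightarrow> real" where
  "mellin_ratio k j x = mellin (k * x) * mellin (j * x) / mellin ((k + j) * x)"

lemma mellin_pos: "y > 0 \<Longrightarrow> mellin y > 0"
  using real_zeta_ge_1[of "y + 1"] by (simp add: mellin_def)

definition mellin_logderiv :: "real \<Rightarrow> real" where
  "mellin_logderiv y = Digamma (y + 1) + real_zeta' (y + 1) / real_zeta (y + 1)"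

lemma has_real_derivative_mellin:
  assumes "y > 0"
  shows "(mellin has_real_derivative mellin y * mellin_logderiv y) (at y)"
proof -
  have "real_zeta (y + 1) > 0" using real_zeta_ge_1[of "y + 1"] assms by simp
  moreover have "y + 1 \<notin> \<int>\<^sub>\<le>\<^sub>0" using assms by (auto elim!: nonpos_Ints_cases)
  ultimately show ?thesis
    unfolding mellin_def [abs_def] mellin_logderiv_def using assms
    by (auto intro!: derivative_eq_intros has_real_derivative_real_zeta [THEN DERIV_chain2] simp: field_simps)
qed

text \<open>Logarithms enclose \<open>Digamma\<close>, so its increment is at most ln ((b + 1) / a),
  and it is at least 0 by monotonicity. The quotient of zeta' by zeta is at most 1 in absolute value
  at both arguments, since these are at least 3.\<close>

lemma mellin_logderiv_diff:
  assumes "a \<ge> 2" "b \<ge> a"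
  shows "mellin_logderiv b - mellin_logderiv a \<le> (b + 1) / a + 1"
    and "mellin_logderiv b - mellin_logderiv a \<ge> - 2"
proof -
  have Z: "\<bar>real_zeta' y / real_zeta y\<bar> \<le> 1" if "y \<ge> 3" for y
  proof -
    have "\<bar>real_zeta' y\<bar> \<le> 1" "real_zeta y \<ge> 1" using that abs_real_zeta'_le real_zeta_ge_1[of y] by auto
    then show ?thesis by (simp add: divide_le_eq)
  qed
  have "ln ((b + 1) / a) \<le> (b + 1) / a - 1"
    using assms by (intro ln_le_minus_one) auto
  moreover have "ln ((b + 1) / a) = ln (b + 1) - ln a" using assms by (simp add: ln_div)
  moreover have "Digamma (b + 1) \<le> ln (b + 1)" "ln a \<le> Digamma (a + 1)" "Digamma (a + 1) \<le> Digamma (b + 1)"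
    using assms by (auto intro!: Digamma_le_ln Digamma_real_mono)
  ultimately show "mellin_logderiv b - mellin_logderiv a \<le> (b + 1) / a + 1"
    and "mellin_logderiv b - mellin_logderiv a \<ge> - 2"
    unfolding mellin_logderiv_def using Z[of "a + 1"] Z[of "b + 1"] assms unfolding abs_le_iff by linarith+
qed

definition mellin_ratio_logderiv :: "nat \<Rightarrow> nat \<Rightarrow> real \<Rightarrow> real" where
  "mellin_ratio_logderiv k j x =
     k * mellin_logderiv (k * x) + j * mellin_logderiv (j * x) - (k + j) * mellin_logderiv ((k + j) * x)"

lemma has_real_derivative_mellin_ratio:
  assumes "k \<ge> 1" "j \<ge> 1" "x > 0"
  shows "(mellin_ratio k j has_real_derivative mellin_ratio k j x * mellin_ratio_logderiv k j x) (at x)"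
proof -
  have pos: "mellin (k * x) > 0" "mellin (j * x) > 0" "mellin ((k + j) * x) > 0"
    using assms by (auto intro!: mellin_pos mult_pos_pos)
  have D: "((\<lambda>x. mellin (real i * x)) has_real_derivative mellin (i * x) * mellin_logderiv (i * x) * i) (at x)"
    if "i \<ge> 1" for i
    by (rule DERIV_chain2[where g = "\<lambda>x. real i * x", OF has_real_derivative_mellin])
       (use that assms in \<open>auto intro!: derivative_eq_intros\<close>)
  have D3: "((\<lambda>x. mellin ((real k + real j) * x)) has_real_derivative
      mellin ((k + j) * x) * mellin_logderiv ((k + j) * x) * (real k + real j)) (at x)"
    using D[of "k + j"] assms by simp
  show ?thesis
    unfolding mellin_ratio_def [abs_def] mellin_ratio_logderiv_def
    by (rule DERIV_cong[OF DERIV_divide[OF DERIV_mult[OF D[OF assms(1)] D[OF assms(2)]] D3]])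
       (use pos in \<open>simp_all add: field_simps\<close>)
qed

text \<open>As the coefficients balance, the expression is minus a weighted sum of increments of
  \<open>mellin_logderiv\<close>. Each weight cancels against the denominator in the bound for its
  increment, so the sum is at most 3 (k + j) + 1, and k + j >= 2 absorbs the 1.\<close>

lemma abs_mellin_ratio_logderiv_le:
  assumes "k \<ge> 1" "j \<ge> 1" "x \<ge> 2"
  shows "\<bar>mellin_ratio_logderiv k j x\<bar> \<le> 7 / 2 * (real k + real j)"
proof -
  define d where "d = (\<lambda>i. mellin_logderiv ((real k + real j) * x) - mellin_logderiv (real i * x))"
  have d: "real i * d i \<le> real k + real j + 1 / 2 + real i \<and> real i * d i \<ge> - 2 * real i"
    if "i = k \<or> i = j" for i
  proof -
    have i: "real i \<ge> 1" "real i \<le> real k + real j" using that assms by auto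
    have "1 * 2 \<le> real i * x" using i assms by (intro mult_mono) auto
    moreover have "real i * x \<le> (real k + real j) * x" using i assms by (intro mult_right_mono) auto
    ultimately have *: "d i \<le> ((real k + real j) * x + 1) / (real i * x) + 1" "d i \<ge> - 2"
      unfolding d_def using mellin_logderiv_diff by auto
    have "real i * d i \<le> real i * (((real k + real j) * x + 1) / (real i * x) + 1)"
      using * i by (intro mult_left_mono) auto
    also have "\<dots> = real k + real j + 1 / x + real i"
      using i assms by (simp add: field_simps)
    also have "\<dots> \<le> real k + real j + 1 / 2 + real i"
      using assms by (simp add: field_simps)
    finally have "real i * d i \<le> real k + real j + 1 / 2 + real i" .
    moreover have "real i * d i \<ge> real i * (- 2)" using * i by (intro mult_left_mono) auto
    ultimately show ?thesis by simp
  qed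
  define A B where "A = real k * d k" and "B = real j * d j"
  have "mellin_ratio_logderiv k j x = - (A + B)"
    by (simp add: mellin_ratio_logderiv_def A_def B_def d_def algebra_simps)
  moreover have "real k + real j \<ge> 2" using assms by simp
  moreover have "A \<le> real k + real j + 1 / 2 + real k" "A \<ge> - 2 * real k"
      "B \<le> real k + real j + 1 / 2 + real j" "B \<ge> - 2 * real j"
    unfolding A_def B_def using d by blast+
  ultimately show ?thesis unfolding abs_le_iff by auto
qed

text \<open>The logarithm of the quotient does not increase with \<open>x\<close>, because
  \<open>Digamma\<close> is monotone. The largest value is therefore at x = 2, where the Gamma
  values are factorials.\<close>

lemma Gamma_ratio_le:
  assumes "k \<ge> 1" "j \<ge> 1" "x \<ge> 2"
  shows "Gamma (real k * x + 1) * Gamma (real j * x + 1) / Gamma ((real k + real j) * x + 1)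
    \<le> fact (2 * k) * fact (2 * j) / fact (2 * (k + j))"
proof -
  let ?g = "\<lambda>x. ln_Gamma (real k * x + 1) + ln_Gamma (real j * x + 1) - ln_Gamma ((real k + real j) * x + 1)"
  have pos: "real k * y + 1 > 0" "real j * y + 1 > 0" "(real k + real j) * y + 1 > 0" if "y \<ge> 2" for y
    using that by (auto intro!: add_nonneg_pos)
  have "?g x \<le> ?g 2"
  proof (rule DERIV_nonpos_imp_nonincreasing[where f = ?g])
    fix y assume y: "2 \<le> y" "y \<le> x"
    have "(?g has_real_derivative Digamma (real k * y + 1) * real k + Digamma (real j * y + 1) * real j
        - Digamma ((real k + real j) * y + 1) * (real k + real j)) (at y)"
      using pos[OF y(1)] by (auto intro!: derivative_eq_intros simp: mult.commute)
    moreover have "Digamma (real k * y + 1) * real k \<le> Digamma ((real k + real j) * y + 1) * real k"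
      using pos[OF y(1)] y by (intro mult_right_mono Digamma_real_mono) auto
    moreover have "Digamma (real j * y + 1) * real j \<le> Digamma ((real k + real j) * y + 1) * real j"
      using pos[OF y(1)] y by (intro mult_right_mono Digamma_real_mono) auto
    ultimately show "\<exists>l. (?g has_real_derivative l) (at y) \<and> l \<le> 0"
      by (intro exI conjI) (auto simp: distrib_left)
  qed (use assms in auto)
  then have le: "exp (?g x) \<le> exp (?g 2)" by (simp only: exp_le_cancel_iff)
  have e: "exp (?g y) = Gamma (real k * y + 1) * Gamma (real j * y + 1) / Gamma ((real k + real j) * y + 1)"
    if "y \<ge> 2" for y
    using pos[OF that] by (simp add: exp_add exp_diff Gamma_real_pos_exp)
  have "Gamma (real i * 2 + 1) = fact (2 * i)" for i
    using Gamma_fact[of "2 * i", where 'a = real] by (simp add: add.commute mult.commute)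
  then have "exp (?g 2) = fact (2 * k) * fact (2 * j) / fact (2 * (k + j))"
    using e[of 2] by (simp only: of_nat_add [symmetric] order_refl)
  with le e[OF assms(3)] show ?thesis by (simp only:)
qed

text \<open>With r = k + j the left side is the reciprocal of the binomial coefficient 2r over 2k.
  Since 2 <= 2k <= 2r - 2, unimodality makes that coefficient at least 2r over 2, which is r (2 r -
  1).\<close>

lemma fact_ratio_le:
  assumes "k \<ge> 1" "j \<ge> 1"
  shows "fact (2 * k) * fact (2 * j) / fact (2 * (k + j)) \<le> 1 / (real (k + j) * (2 * real (k + j) - 1))"
proof -
  define r where "r = k + j"
  have le: "2 * r choose 2 \<le> 2 * r choose (2 * k)"
  proof (cases "2 * (2 * k) \<le> 2 * r")
    case True
    then show ?thesis using assms by (intro binomial_mono) auto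
  next
    case False
    have "2 * r choose (2 * k) = 2 * r choose (2 * j)"
      using binomial_symmetric[of "2 * k" "2 * r"] by (simp add: r_def)
    then show ?thesis using False assms by (auto intro!: binomial_mono simp: r_def)
  qed
  have c2: "real (2 * r choose 2) = real r * (2 * real r - 1)"
  proof -
    have "2 * r choose 2 = r * (2 * r - 1)" by (simp add: choose_two)
    then show ?thesis using assms by (simp add: r_def of_nat_diff)
  qed
  have "fact (2 * k) * fact (2 * j) / fact (2 * (k + j)) = 1 / real (2 * r choose (2 * k))"
    by (subst binomial_fact) (auto simp: r_def)
  also have "\<dots> \<le> 1 / real (2 * r choose 2)"
    using le assms by (intro divide_left_mono) (auto simp: r_def zero_less_binomial_iff)
  finally show ?thesis unfolding c2 unfolding r_def .
qed

text \<open>The constant 25/16 is (5/4)^2 from the two zeta values in the numerator, whose arguments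
  are at least 3; the one in the denominator is at least 1.\<close>

lemma mellin_ratio_bounds:
  assumes "k \<ge> 1" "j \<ge> 1" "x \<ge> 2"
  shows "0 \<le> mellin_ratio k j x"
    and "mellin_ratio k j x \<le> 25 / 16 / (real (k + j) * (2 * real (k + j) - 1))"
proof -
  let ?r = "real k + real j"
  have x: "real k * x > 0" "real j * x > 0" "?r * x > 0" using assms by auto
  show "0 \<le> mellin_ratio k j x"
    unfolding mellin_ratio_def using x[THEN mellin_pos] by simp
  have "1 * 2 \<le> real k * x" "1 * 2 \<le> real j * x" using assms by (intro mult_mono; simp)+
  then have Z: "real_zeta (real k * x + 1) \<le> 5 / 4" "real_zeta (real j * x + 1) \<le> 5 / 4"
      "real_zeta (real k * x + 1) \<ge> 1" "real_zeta (real j * x + 1) \<ge> 1" "real_zeta (?r * x + 1) \<ge> 1"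
    using x by (auto intro!: real_zeta_ge_1 real_zeta_le_5_4 simp del: le_divide_eq_numeral1)
  let ?G = "Gamma (real k * x + 1) * Gamma (real j * x + 1) / Gamma (?r * x + 1)"
  have "real_zeta (real k * x + 1) * real_zeta (real j * x + 1) / real_zeta (?r * x + 1) \<le>
     real_zeta (real k * x + 1) * real_zeta (real j * x + 1) / 1"
    using Z by (intro divide_left_mono) auto
  also have "real_zeta (real k * x + 1) * real_zeta (real j * x + 1) / 1 \<le> 5 / 4 * (5 / 4)"
    unfolding div_by_1 using Z by (intro mult_mono) auto
  finally have Z': "real_zeta (real k * x + 1) * real_zeta (real j * x + 1) / real_zeta (?r * x + 1) \<le> 25 / 16"
    by simp
  have "mellin_ratio k j x =
     real_zeta (real k * x + 1) * real_zeta (real j * x + 1) / real_zeta (?r * x + 1) * ?G"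
    by (simp add: mellin_ratio_def mellin_def mult_ac)
  also have "\<dots> \<le> 25 / 16 * ?G"
    using Z' x by (intro mult_right_mono) auto
  also have "?G \<le> 1 / (real (k + j) * (2 * real (k + j) - 1))"
    using Gamma_ratio_le[OF assms] fact_ratio_le[OF assms(1,2)] by linarith
  finally show "mellin_ratio k j x \<le> 25 / 16 / (real (k + j) * (2 * real (k + j) - 1))"
    by simp
qed

section \<open>The normalised multiple zeta function\<close>

text \<open>
  This is \<open>\<zeta>\<^sub>r(-x)\<close> multiplied by \<open>(-1)\<^sup>r (2\<pi>)\<^sup>r\<^sup>x \<pi> r / mellin (r x)\<close>; the recursion is Newton's, rewritten
  by the functional equation.
\<close>

function normalized_zeta :: "nat \<Rightarrow> real \<Rightarrow> real" where
  "normalized_zeta r x = sin (real r * (pi * x / 2)) +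
     (\<Sum>k\<in>{1..<r}. mellin_ratio k (r - k) x * (sin (real k * (pi * x / 2)) * normalized_zeta (r - k) x)
        / (pi * real (r - k)))"
  by auto
termination by (relation "Wellfounded.measure fst") auto

declare normalized_zeta.simps [simp del]

definition perturbation :: "nat \<Rightarrow> real \<Rightarrow> real" where
  "perturbation r x = normalized_zeta r x - sin (real r * (pi * x / 2))"

lemma perturbation_eq:
  "perturbation r x =
     (\<Sum>k\<in>{1..<r}. mellin_ratio k (r - k) x * (sin (real k * (pi * x / 2)) *
       (sin (real (r - k) * (pi * x / 2)) + perturbation (r - k) x)) / (pi * real (r - k)))"
  unfolding perturbation_def by (subst normalized_zeta.simps) simp

text \<open>Every summand of the recursion has a factor sin(k pi m).\<close>

lemma perturbation_even_integer: "perturbation r (2 * real m) = 0"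
proof -
  have "sin (real k * (pi * (2 * real m) / 2)) = 0" for k
    using sin_npi[of "k * m"] by (simp add: mult_ac)
  then show ?thesis by (subst perturbation_eq) simp
qed

text \<open>One summand of the recursion, with the perturbation of lower index abstracted to
  \<open>p\<close>. For the value, |sin + p| <= 3/2 and pi j >= 3 give the factor 1/2. For the
  derivative, \<open>mellin_ratio\<close> contributes 7/4 (k + j), the first sine 3/4 k and the
  bracket 3/4; as j >= 1, these add up to at most 5/2 (k + j).\<close>

lemma perturbation_summand:
  fixes p p' :: "real \<Rightarrow> real"
  assumes kj: "k \<ge> 1" "j \<ge> 1" and x: "x \<ge> 2"
    and p: "\<bar>p x\<bar> \<le> 1 / 4" "(p has_real_derivative p' x) (at x)" "\<bar>p' x\<bar> \<le> real j * pi / 4"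
  defines "t \<equiv> (\<lambda>x. mellin_ratio k j x * (sin (real k * (pi * x / 2)) *
       (sin (real j * (pi * x / 2)) + p x)) / (pi * real j))"
  defines "B \<equiv> 25 / 16 / (real (k + j) * (2 * real (k + j) - 1))"
  shows "\<bar>t x\<bar> \<le> B / 2" "\<exists>t'. (t has_real_derivative t') (at x) \<and> \<bar>t'\<bar> \<le> B * (5 / 2 * real (k + j))"
proof -
  define w where "w = mellin_ratio k j x"
  define l where "l = mellin_ratio_logderiv k j x"
  define sk sj ck cj where "sk = sin (real k * (pi * x / 2))" and "sj = sin (real j * (pi * x / 2))"
    and "ck = cos (real k * (pi * x / 2))" and "cj = cos (real j * (pi * x / 2))"
  have w: "0 \<le> w" "w \<le> B" using mellin_ratio_bounds[OF kj x] by (auto simp: w_def B_def)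
  have l: "\<bar>l\<bar> \<le> 7 / 2 * real (k + j)" using abs_mellin_ratio_logderiv_le[OF kj x] by (simp add: l_def)
  have tr: "\<bar>sk\<bar> \<le> 1" "\<bar>sj\<bar> \<le> 1" "\<bar>ck\<bar> \<le> 1" "\<bar>cj\<bar> \<le> 1"
    by (auto simp: sk_def sj_def ck_def cj_def)
  have f: "\<bar>sj + p x\<bar> \<le> 3 / 2" using tr p(1) by linarith
  have pj: "pi * real j \<ge> 3" using kj pi_gt3 mult_mono[of 3 pi 1 "real j"] by simp
  have a: "\<bar>sk * (sj + p x)\<bar> \<le> 3 / 2"
    unfolding abs_mult using mult_mono[OF tr(1) f] by simp
  have a': "\<bar>sk * (sj + p x) / (pi * real j)\<bar> \<le> 1 / 2"
    using a pj by (simp add: abs_mult divide_le_eq)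
  have "\<bar>t x\<bar> = w * \<bar>sk * (sj + p x) / (pi * real j)\<bar>"
    using w by (simp add: t_def w_def sk_def sj_def abs_mult)
  also have "\<dots> \<le> B * (1 / 2)" using w a' by (intro mult_mono) auto
  finally show "\<bar>t x\<bar> \<le> B / 2" by simp
  define t' where "t' = (w * l * (sk * (sj + p x)) + w * (real k * (pi / 2) * ck * (sj + p x)
      + sk * (real j * (pi / 2) * cj + p' x))) / (pi * real j)"
  have D: "(t has_real_derivative t') (at x)"
    unfolding t_def t'_def w_def l_def sk_def sj_def ck_def cj_def
    by (rule DERIV_cong, rule DERIV_cdivide, rule DERIV_mult,
        rule has_real_derivative_mellin_ratio, use kj x in simp_all)
       ((rule derivative_eq_intros p(2) refl | simp)+, simp add: algebra_simps)
  have b1: "\<bar>l * (sk * (sj + p x) / (pi * real j))\<bar> \<le> 7 / 4 * real (k + j)"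
    unfolding abs_mult [of l] using mult_mono[OF l a'] by simp
  have "\<bar>real k * (pi / 2) * (ck * (sj + p x))\<bar> \<le> real k * (pi / 2) * (3 / 2)"
  proof -
    have "\<bar>ck * (sj + p x)\<bar> \<le> 3 / 2" unfolding abs_mult using mult_mono[OF tr(3) f] by simp
    then have "real k * (pi / 2) * \<bar>ck * (sj + p x)\<bar> \<le> real k * (pi / 2) * (3 / 2)"
      by (intro mult_left_mono) auto
    then show ?thesis by (simp add: abs_mult)
  qed
  then have b2: "\<bar>real k * (pi / 2) * (ck * (sj + p x)) / (pi * real j)\<bar> \<le> 3 / 4 * real k"
    using kj mult_left_mono[of 1 "real j" "real k"]  by (simp add: abs_mult divide_simps) 
  have "\<bar>real j * (pi / 2) * cj\<bar> \<le> real j * (pi / 2) * 1"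
    unfolding abs_mult using tr by (intro mult_mono) auto
  then have "\<bar>real j * (pi / 2) * cj + p' x\<bar> \<le> 3 / 4 * (pi * real j)"
    using p(3) by (intro order_trans[OF abs_triangle_ineq]) (simp add: mult.commute)
  then have "\<bar>sk\<bar> * \<bar>real j * (pi / 2) * cj + p' x\<bar> \<le> 1 * (3 / 4 * (pi * real j))"
    using tr by (intro mult_mono) auto
  then have b3: "\<bar>sk * (real j * (pi / 2) * cj + p' x) / (pi * real j)\<bar> \<le> 3 / 4"
    using pj by (simp add: abs_mult divide_le_eq)
  define u where "u = l * (sk * (sj + p x) / (pi * real j)) + real k * (pi / 2) * (ck * (sj + p x)) / (pi * real j)
      + sk * (real j * (pi / 2) * cj + p' x) / (pi * real j)"
  have t'_eq: "t' = w * u"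
    unfolding t'_def u_def by (simp add: add_divide_distrib distrib_left mult_ac)
  have "real j \<ge> 1" using kj by simp
  then have "7 / 4 * real (k + j) + 3 / 4 * real k + 3 / 4 \<le> 5 / 2 * real (k + j)"
    by (simp add: field_simps)
  moreover have "\<bar>u\<bar> \<le> 7 / 4 * real (k + j) + 3 / 4 * real k + 3 / 4"
    unfolding u_def by (intro order_trans[OF abs_triangle_ineq] add_mono b1 b2 b3)
  ultimately have "\<bar>u\<bar> \<le> 5 / 2 * real (k + j)" by (rule order_trans [rotated])
  then have "w * \<bar>u\<bar> \<le> B * (5 / 2 * real (k + j))"
    using w by (intro mult_mono) auto
  then have "\<bar>t'\<bar> \<le> B * (5 / 2 * real (k + j))"
    using w(1) unfolding t'_eq by (simp only: abs_mult abs_of_nonneg)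
  with D show "\<exists>t'. (t has_real_derivative t') (at x) \<and> \<bar>t'\<bar> \<le> B * (5 / 2 * real (k + j))"
    by (intro exI[of _ t'] conjI)
qed

text \<open>The r - 1 summands are controlled by (r - 1) / (r (2 r - 1)) <= 1/6. The constant 25/36
  leaves room on both sides: the sum of the derivatives gives 125/192, while the induction and the
  later count of zeros call for a value below pi / 4.\<close>

lemma perturbation_bounds:
  assumes "r \<ge> 1" "x \<ge> 2"
  shows "\<bar>perturbation r x\<bar> \<le> 1 / 4 \<and>
    (\<exists>D. (perturbation r has_real_derivative D) (at x) \<and> \<bar>D\<bar> \<le> real r * (25 / 36))"
  using assms(1)
proof (induction r rule: less_induct)
  case (less r)
  define B where "B = 25 / 16 / (real r * (2 * real r - 1))"
  define t where "t = (\<lambda>k x. mellin_ratio k (r - k) x * (sin (real k * (pi * x / 2)) *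
       (sin (real (r - k) * (pi * x / 2)) + perturbation (r - k) x)) / (pi * real (r - k)))"
  have P: "perturbation r = (\<lambda>x. \<Sum>k\<in>{1..<r}. t k x)"
    by (rule ext, subst perturbation_eq) (simp add: t_def)
  have t: "\<bar>t k x\<bar> \<le> B / 2 \<and> (\<exists>t'. (t k has_real_derivative t') (at x) \<and> \<bar>t'\<bar> \<le> B * (5 / 2 * real r))"
    if k: "k \<in> {1..<r}" for k
  proof -
    have j: "r - k < r" "r - k \<ge> 1" using k by auto
    from less.IH[OF this] obtain D where D: "\<bar>perturbation (r - k) x\<bar> \<le> 1 / 4"
      "(perturbation (r - k) has_real_derivative D) (at x)" "\<bar>D\<bar> \<le> real (r - k) * (25 / 36)" by blast
    have "real (r - k) * (25 / 36) \<le> real (r - k) * (pi / 4)"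
      using pi_gt3 by (intro mult_left_mono) auto
    then have D3: "\<bar>D\<bar> \<le> real (r - k) * pi / 4" using D(3) by simp
    have kj: "k + (r - k) = r" using k by auto
    have "k \<ge> 1" using k by simp
    note bounds = perturbation_summand[where p' = "\<lambda>_. D", OF this j(2) assms(2) D(1,2) D3, unfolded kj]
    show ?thesis
      unfolding t_def B_def using bounds by (intro conjI)
  qed
  then have "\<forall>k\<in>{1..<r}. \<exists>t'. (t k has_real_derivative t') (at x) \<and> \<bar>t'\<bar> \<le> B * (5 / 2 * real r)"
    by blast
  from bchoice[OF this] obtain t' where t': "\<And>k. k \<in> {1..<r} \<Longrightarrow> (t k has_real_derivative t' k) (at x)"
      "\<And>k. k \<in> {1..<r} \<Longrightarrow> \<bar>t' k\<bar> \<le> B * (5 / 2 * real r)" by blast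
  have rB: "real (r - 1) * B \<le> 25 / 96"
  proof (cases "r = 1")
    case False
    then have r: "r \<ge> 2" using less.prems by simp
    \<comment> \<open>A factored form of 6 (r - 1) <= r (2 r - 1), with equality in the worst case r
      = 2.\<close>
    have "0 \<le> (2 * real r - 3) * (real r - 2)" using r by simp
    then have "6 * (real r - 1) \<le> real r * (2 * real r - 1)" by (simp add: algebra_simps)
    then have "25 / 16 * (real r - 1) \<le> 25 / 96 * (real r * (2 * real r - 1))" by simp
    moreover have "real r * (2 * real r - 1) > 0" using r by (intro mult_pos_pos) auto
    moreover have "real (r - 1) * B = 25 / 16 * (real r - 1) / (real r * (2 * real r - 1))"
      using r by (simp add: B_def of_nat_diff)
    ultimately show ?thesis by (simp only: pos_divide_le_eq)
  qed auto
  have "\<bar>perturbation r x\<bar> \<le> (\<Sum>k\<in>{1..<r}. B / 2)"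
    unfolding P by (rule order_trans[OF sum_abs sum_mono]) (use t in auto)
  also have "\<dots> = real (r - 1) * B / 2" by simp
  also have "\<dots> \<le> 1 / 4" using rB by linarith
  finally have 1: "\<bar>perturbation r x\<bar> \<le> 1 / 4" .
  have "(perturbation r has_real_derivative (\<Sum>k\<in>{1..<r}. t' k)) (at x)"
    unfolding P by (rule DERIV_sum) (use t' in auto)
  moreover have "\<bar>\<Sum>k\<in>{1..<r}. t' k\<bar> \<le> real r * (25 / 36)"
  proof -
    have "\<bar>\<Sum>k\<in>{1..<r}. t' k\<bar> \<le> (\<Sum>k\<in>{1..<r}. B * (5 / 2 * real r))"
      by (rule order_trans[OF sum_abs sum_mono]) (use t' in auto)
    also have "\<dots> = (real (r - 1) * B) * (5 / 2 * real r)" by simp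
    also have "\<dots> \<le> 25 / 96 * (5 / 2 * real r)" using rB by (intro mult_right_mono) auto
    also have "\<dots> \<le> real r * (25 / 36)" by simp
    finally show ?thesis .
  qed
  ultimately show ?case using 1 by blast
qed

text \<open>The affine change u = r pi (x - 2 m) / 2 maps the interval onto (0, r pi) and the
  leading term to (-1)^(r m) sin u. It multiplies the derivative of the perturbation by 2 / (r pi),
  which removes its growth in \<open>r\<close>.\<close>

lemma card_zeros_normalized_zeta:
  fixes m r :: nat
  assumes r: "r \<ge> 1" and m: "m \<ge> 1"
  defines "Z \<equiv> {x. 2 * real m < x \<and> x < 2 * real m + 2 \<and> normalized_zeta r x = 0}"
  shows "finite Z \<and> card Z = r - 1"
proof -
  define c where "c = 2 / (real r * pi)"
  define \<phi> where "\<phi> = (\<lambda>u. 2 * real m + c * u)"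
  have c: "c > 0" using r by (simp add: c_def)
  obtain D where D: "\<And>x. x \<ge> 2 \<Longrightarrow> (perturbation r has_real_derivative D x) (at x)"
    "\<And>x. x \<ge> 2 \<Longrightarrow> \<bar>D x\<bar> \<le> real r * (25 / 36)"
    using perturbation_bounds[OF r] by metis
  define q where "q = (\<lambda>u. (-1) ^ (r * m) * perturbation r (\<phi> u))"
  have \<phi>2: "\<phi> u \<ge> 2" if "u \<ge> 0" for u using that m c by (simp add: \<phi>_def add_increasing2)
  have norm_eq: "normalized_zeta r (\<phi> u) = (-1) ^ (r * m) * (sin u + q u)" for u
  proof -
    have "real r * (pi * \<phi> u / 2) = real (r * m) * pi + u"
      using r by (simp add: \<phi>_def c_def field_simps)
    then have "sin (real r * (pi * \<phi> u / 2)) = (-1) ^ (r * m) * sin u"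
      by (simp only: sin_plus_nat_pi)
    moreover have "(-1) ^ (r * m) * q u = perturbation r (\<phi> u)"
      by (simp add: q_def flip: power_mult_distrib mult.assoc)
    ultimately show ?thesis by (simp add: perturbation_def distrib_left)
  qed
  let ?S = "{u. 0 < u \<and> u < real r * pi \<and> sin u + q u = 0}"
  have "finite ?S \<and> card ?S = r - 1"
  proof (rule card_zeros_perturbed_sin)
    fix u assume u: "0 \<le> u" "u \<le> real r * pi"
    show "(q has_real_derivative (-1) ^ (r * m) * (D (\<phi> u) * c)) (at u)"
      unfolding q_def
      by (rule DERIV_cmult, rule DERIV_chain2[where f = "perturbation r" and g = \<phi>, OF D(1)[OF \<phi>2[OF u(1)]]])
         (auto intro!: derivative_eq_intros simp: \<phi>_def)
    have "\<bar>D (\<phi> u) * c\<bar> \<le> real r * (25 / 36) * c"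
      unfolding abs_mult using D(2)[OF \<phi>2[OF u(1)]] c by (simp add: mult_right_mono)
    also have "\<dots> = 25 / (18 * pi)" using r by (simp add: c_def field_simps)
    also have "\<dots> < 1 / 2" using pi_gt3 by (simp add: field_simps)
    finally show "\<bar>(-1) ^ (r * m) * (D (\<phi> u) * c)\<bar> < 1 / 2" by (simp add: abs_mult power_abs)
    show "\<bar>q u\<bar> \<le> 1 / 4"
      using perturbation_bounds[OF r \<phi>2[OF u(1)]] by (simp add: q_def abs_mult power_abs)
  next
    show "q 0 = 0" by (simp add: q_def \<phi>_def perturbation_even_integer)
    have "\<phi> (real r * pi) = 2 * real (m + 1)" using r by (simp add: \<phi>_def c_def)
    then show "q (real r * pi) = 0" unfolding q_def by (simp only: perturbation_even_integer)
  qed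
  moreover have "Z = \<phi> ` ?S"
  proof (intro equalityI subsetI)
    fix x assume x: "x \<in> Z"
    define u where "u = (x - 2 * real m) / c"
    have "x = \<phi> u" using c by (simp add: u_def \<phi>_def)
    moreover have "u \<in> ?S"
      using x norm_eq[of u] c r unfolding \<open>x = \<phi> u\<close> Z_def
      by (auto simp: \<phi>_def zero_less_mult_iff) (simp add: c_def field_simps)
    ultimately show "x \<in> \<phi> ` ?S" by blast
  next
    fix x assume "x \<in> \<phi> ` ?S"
    then obtain u where u: "u \<in> ?S" "x = \<phi> u" by blast
    then show "x \<in> Z"
      using norm_eq[of u] c r by (auto simp: Z_def \<phi>_def) (simp add: c_def field_simps)
  qed
  moreover have "inj_on \<phi> ?S" using c by (auto simp: inj_on_def \<phi>_def)
  ultimately show ?thesis by (simp add: card_image)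
qed

section \<open>Continuation of the multiple zeta function\<close>

text \<open>The right side 2^s pi^(s - 1) sin(pi s / 2) Gamma(1 - s) zeta(1 - s) of the functional
  equation; the Dirichlet series at 1 - s converges for Re s < 0.\<close>

definition reflected_zeta :: "complex \<Rightarrow> complex" where
  "reflected_zeta s = of_real (2 * pi) powr s / of_real pi * sin (of_real pi * s / 2) *
     Gamma (1 - s) * dirichlet_zeta (1 - s)"

text \<open>For Re s <= -1 the functional equation acts as a definition. At the pole s = 1 division
  by zero yields 0; meromorphy constrains only the punctured neighbourhood.\<close>

definition zeta :: "complex \<Rightarrow> complex" where
  "zeta s = (if Re s > -1 then euler_zeta s / (s - 1) else reflected_zeta s)"

lemma holomorphic_reflected_zeta: "reflected_zeta holomorphic_on {s. Re s < 0}"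
proof -
  have "1 - s \<notin> \<int>\<^sub>\<le>\<^sub>0" if "Re s < 0" for s :: complex
  proof
    assume "1 - s \<in> \<int>\<^sub>\<le>\<^sub>0"
    then obtain n where "1 - s = of_int n" "n \<le> 0" by (auto elim!: nonpos_Ints_cases)
    then have "1 - Re s = of_int n" by (metis Re_complex_of_real minus_complex.simps(1) of_real_of_int_eq one_complex.simps(1))
    then show False using that \<open>n \<le> 0\<close> by linarith
  qed
  moreover have "(\<lambda>s. dirichlet_zeta (1 - s)) holomorphic_on {s. Re s < 0}"
    by (rule holomorphic_on_compose_gen[OF _ holomorphic_dirichlet_zeta, unfolded o_def])
       (auto intro!: holomorphic_intros)
  ultimately show ?thesis
    unfolding reflected_zeta_def [abs_def] by (intro holomorphic_intros) auto
qed

lemma reflected_zeta_of_real: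
  assumes "y > 0"
  shows "reflected_zeta (of_real (- y)) =
     of_real (- ((2 * pi) powr (- y) * sin (pi * y / 2) * Gamma (1 + y) * real_zeta (1 + y) / pi))"
proof -
  have "of_real (2 * pi) powr complex_of_real (- y) = of_real ((2 * pi) powr (- y))"
    by (rule powr_of_real) simp
  moreover have "sin (of_real pi * complex_of_real (- y) / 2) = of_real (- sin (pi * y / 2))"
    unfolding sin_minus [symmetric] by (simp add: sin_of_real [symmetric])
  moreover have "1 - complex_of_real (- y) = of_real (1 + y)" by simp
  ultimately show ?thesis
    unfolding reflected_zeta_def using assms
    by (simp only: Gamma_complex_of_real dirichlet_zeta_of_real) (simp add: dirichlet_zeta_of_real)
qed

text \<open>Both sides are holomorphic in the strip and agree on its real segment by the functional
  equation, so the identity theorem applies.\<close>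

lemma euler_zeta_eq_reflected_zeta:
  assumes s: "-1 < Re s" "Re s < 0"
  shows "euler_zeta s = (s - 1) * reflected_zeta s"
proof -
  let ?S = "{s. -1 < Re s} \<inter> {s. Re s < 0}"
  let ?U = "complex_of_real ` {-1<..<0}"
  have "euler_zeta s - (s - 1) * reflected_zeta s = 0"
  proof (rule analytic_continuation[where S = ?S and U = ?U and \<xi> = "of_real (- 1 / 2)"
      and f = "\<lambda>s. euler_zeta s - (s - 1) * reflected_zeta s"])
    show "(\<lambda>s. euler_zeta s - (s - 1) * reflected_zeta s) holomorphic_on ?S"
      by (intro holomorphic_intros holomorphic_on_subset[OF holomorphic_euler_zeta]
          holomorphic_on_subset[OF holomorphic_reflected_zeta]) auto
    show "open ?S" by (intro open_Int open_halfspace_Re_gt open_halfspace_Re_lt)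
    show "connected ?S"
      by (intro convex_connected convex_Int convex_halfspace_Re_gt convex_halfspace_Re_lt)
    show "?U \<subseteq> ?S" by auto
    show "of_real (- 1 / 2) islimpt ?U"
      unfolding islimpt_approachable
    proof (intro allI impI)
      fix e :: real assume e: "e > 0"
      define x where "x = - 1 / 2 + min (e / 2) (1 / 4)"
      have "dist (complex_of_real x) (of_real (- 1 / 2)) = \<bar>x - (- 1 / 2)\<bar>"
        by (simp only: dist_norm of_real_diff [symmetric] norm_of_real)
      moreover have "x \<in> {-1<..<0}" "x \<noteq> - 1 / 2" "\<bar>x - (- 1 / 2)\<bar> < e" using e by (auto simp: x_def)
      ultimately show "\<exists>x'\<in>?U. x' \<noteq> of_real (- 1 / 2) \<and> dist x' (of_real (- 1 / 2)) < e"
        by (intro bexI[of _ "of_real x"]) (auto simp only: of_real_eq_iff)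
    qed
    show "euler_zeta z - (z - 1) * reflected_zeta z = 0" if zU: "z \<in> ?U" for z
    proof -
      obtain x where x: "z = of_real x" "-1 < x" "x < 0" using zU by auto
      define a where "a = - x"
      have a: "0 < a" "a < 1" using x by (auto simp: a_def)
      have z: "z = of_real (- a)" using x by (simp add: a_def)
      have "(z - 1) * reflected_zeta z = of_real ((- a - 1) * (- ((2 * pi) powr (- a) * sin (pi * a / 2) * Gamma (1 + a) * real_zeta (1 + a) / pi)))"
        unfolding z reflected_zeta_of_real[OF a(1)] by simp
      also have "(- a - 1) * (- ((2 * pi) powr (- a) * sin (pi * a / 2) * Gamma (1 + a) * real_zeta (1 + a) / pi))
         = (a + 1) / pi * (2 * pi) powr (- a) * sin (pi * a / 2) * Gamma (1 + a) * real_zeta (1 + a)"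
        by (simp add: field_simps)
      finally show ?thesis
        using euler_zeta_functional_equation[OF a] by (simp only: z) simp
    qed
  qed (use s in auto)
  then show ?thesis by simp
qed

lemma zeta_eq_reflected_zeta: "Re s < 0 \<Longrightarrow> zeta s = reflected_zeta s"
proof -
  assume "Re s < 0"
  moreover have "s - 1 \<noteq> 0" using \<open>Re s < 0\<close> by auto
  ultimately show ?thesis using euler_zeta_eq_reflected_zeta[of s] by (simp add: zeta_def)
qed

lemma zeta_eq_dirichlet_zeta: "Re s > 1 \<Longrightarrow> zeta s = dirichlet_zeta s"
proof -
  assume "Re s > 1"
  moreover have "s - 1 \<noteq> 0" using \<open>Re s > 1\<close> by auto
  ultimately show ?thesis using euler_zeta_eq_dirichlet_zeta[of s] by (simp add: zeta_def)
qed

text \<open>Since \<open>zeta\<close> is \<open>reflected_zeta\<close> on all of Re s < 0, the line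
  Re s = -1 where its definition switches is interior to the first case.\<close>

lemma analytic_zeta:
  assumes "s \<noteq> 1"
  shows "zeta analytic_on {s}"
proof (cases "Re s < 0")
  case True
  have "zeta holomorphic_on {s. Re s < 0}"
    using holomorphic_reflected_zeta by (rule holomorphic_transform) (simp add: zeta_eq_reflected_zeta)
  then show ?thesis
    by (rule holomorphic_on_imp_analytic_at) (use True in \<open>auto simp: open_halfspace_Re_lt\<close>)
next
  case False
  let ?S = "{s. Re s > -1} - {1}"
  have "(\<lambda>s. euler_zeta s / (s - 1)) holomorphic_on ?S"
    by (intro holomorphic_intros holomorphic_on_subset[OF holomorphic_euler_zeta]) auto
  then have "zeta holomorphic_on ?S"
    by (rule holomorphic_transform) (simp add: zeta_def)
  then show ?thesis
    by (rule holomorphic_on_imp_analytic_at) (use False assms in \<open>auto intro!: open_Diff simp: open_halfspace_Re_gt\<close>)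
qed

lemma meromorphic_zeta: "zeta meromorphic_on UNIV"
proof -
  have "zeta meromorphic_on {s}" for s
  proof (cases "s = 1")
    case False
    then show ?thesis by (intro analytic_on_imp_meromorphic_on analytic_zeta)
  next
    case True
    have "euler_zeta analytic_on {s. Re s > -1}"
      using holomorphic_euler_zeta by (simp add: analytic_on_open open_halfspace_Re_gt)
    then have "(\<lambda>s. euler_zeta s / (s - 1)) meromorphic_on {s. Re s > -1}"
      by (intro meromorphic_intros analytic_on_imp_meromorphic_on)
    also have "?this \<longleftrightarrow> zeta meromorphic_on {s. Re s > -1}"
    proof (rule meromorphic_on_cong)
      fix z :: complex assume "z \<in> {s. Re s > -1}"
      then have "eventually (\<lambda>w. w \<in> {s. Re s > -1}) (at z)"
        by (intro eventually_at_in_open') (auto simp: open_halfspace_Re_gt)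
      then show "eventually (\<lambda>w. euler_zeta w / (w - 1) = zeta w) (at z)"
        by eventually_elim (simp add: zeta_def)
    qed simp
    finally show ?thesis using True by (auto intro: meromorphic_on_subset)
  qed
  then show ?thesis using meromorphic_on_meromorphic_at by blast
qed

text \<open>Newton's identity solved for the function of highest index. The recursion is pointwise,
  so values where a factor has a pole carry no meaning; \<open>remove_sings\<close> corrects them
  later.\<close>

fun newton_zeta :: "nat \<Rightarrow> complex \<Rightarrow> complex" where
  "newton_zeta 0 s = 1"
| "newton_zeta (Suc r) s =
     (\<Sum>k\<le>r. (-1) ^ k * zeta (of_nat (Suc k) * s) * newton_zeta (r - k) s) / of_nat (Suc r)"

lemma newton_zeta_eq_multizeta_series:
  assumes "Re s > 1"
  shows "newton_zeta r s = multizeta_series r s"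
proof (induction r rule: less_induct)
  case (less r)
  show ?case
  proof (cases r)
    case [simp]: (Suc q)
    have "newton_zeta r s = (\<Sum>k\<le>q. (-1) ^ k * dirichlet_zeta (of_nat (Suc k) * s) * multizeta_series (q - k) s) / of_nat (Suc q)"
      unfolding Suc newton_zeta.simps
    proof (intro arg_cong2[where f = "(/)"] sum.cong refl)
      fix k assume "k \<in> {..q}"
      have "1 * 1 < real (Suc k) * Re s"
        using assms by (intro mult_le_less_imp_less) auto
      then show "(-1) ^ k * zeta (of_nat (Suc k) * s) * newton_zeta (q - k) s =
          (-1) ^ k * dirichlet_zeta (of_nat (Suc k) * s) * multizeta_series (q - k) s"
        using less.IH[of "q - k"] by (simp add: zeta_eq_dirichlet_zeta del: of_nat_Suc)
    qed
    also have "\<dots> = of_nat (Suc q) * multizeta_series (Suc q) s / of_nat (Suc q)"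
      by (simp only: newton_identity_multizeta_series[OF assms])
    also have "\<dots> = multizeta_series r s"
      by (simp add: of_nat_neq_0 del: of_nat_Suc)
    finally show ?thesis .
  qed simp
qed

lemma meromorphic_newton_zeta: "newton_zeta r meromorphic_on UNIV"
proof (induction r rule: less_induct)
  case (less r)
  show ?case
  proof (cases r)
    case [simp]: (Suc q)
    have "(\<lambda>s. zeta (of_nat (Suc k) * s)) meromorphic_on UNIV" for k
      by (rule meromorphic_on_compose[OF meromorphic_zeta]) (auto intro!: analytic_intros)
    then have "(\<lambda>s. (\<Sum>k\<le>q. (-1) ^ k * zeta (of_nat (Suc k) * s) * newton_zeta (q - k) s) / of_nat (Suc q)) meromorphic_on UNIV"
      by (intro meromorphic_intros less.IH) auto
    then show ?thesis by (simp add: newton_zeta.simps(2)[abs_def] del: of_nat_Suc)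
  qed (simp add: newton_zeta.simps(1)[abs_def] meromorphic_on_const)
qed

text \<open>A singularity can only come from a factor zeta(k s) with k s = 1. The points 1 / k lie
  neither on the negative axis nor in Re s > 1.\<close>

lemma analytic_newton_zeta:
  assumes "\<And>k. k \<ge> 1 \<Longrightarrow> of_nat k * s \<noteq> 1"
  shows "newton_zeta r analytic_on {s}"
proof (induction r rule: less_induct)
  case (less r)
  show ?case
  proof (cases r)
    case [simp]: (Suc q)
    have "(\<lambda>w. zeta (of_nat (Suc k) * w)) analytic_on {s}" for k
      by (rule analytic_on_compose_gen[where g = zeta and T = "{of_nat (Suc k) * s}", unfolded o_def])
         (use assms[of "Suc k"] in \<open>auto intro!: analytic_intros analytic_zeta simp del: of_nat_Suc\<close>)
    then have "(\<lambda>s. (\<Sum>k\<le>q. (-1) ^ k * zeta (of_nat (Suc k) * s) * newton_zeta (q - k) s) / of_nat (Suc q)) analytic_on {s}"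
      by (intro analytic_intros less.IH) (auto simp: of_nat_neq_0 simp del: of_nat_Suc)
    then show ?thesis by (simp add: newton_zeta.simps(2)[abs_def] del: of_nat_Suc)
  qed (simp add: newton_zeta.simps(1)[abs_def])
qed

section \<open>Uniqueness of the continuation and identification of \<open>multizeta\<close>\<close>

lemma remove_sings_nicely_meromorphic_eq:
  assumes "f nicely_meromorphic_on A" "z \<in> A"
  shows "remove_sings f z = f z"
  using assms unfolding nicely_meromorphic_on_def by (metis remove_sings_at_pole remove_sings_eqI)

text \<open>The difference of nicely meromorphic functions need not be one where poles cancel, so
  its singularities are removed before the identity theorem is applied. Then \<open>f\<close> and
  \<open>g\<close> agree near every point, and a nicely meromorphic function is recovered at a point
  from its values nearby.\<close>

lemma nicely_meromorphic_unique:
  assumes f: "f nicely_meromorphic_on UNIV" and g: "g nicely_meromorphic_on UNIV"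
    and S: "open S" "z0 \<in> S" "\<And>s. s \<in> S \<Longrightarrow> f s = g s"
  shows "f = g"
proof
  fix z
  let ?h = "\<lambda>s. f s - g s"
  have h: "?h meromorphic_on UNIV"
    using f g by (intro meromorphic_intros) (auto simp: nicely_meromorphic_on_def)
  have "eventually (\<lambda>s. s \<in> S) (at z0)" using S by (intro eventually_at_in_open') auto
  moreover have "eventually (\<lambda>s. remove_sings ?h s = ?h s) (at z0)"
    by (intro eventually_remove_sings_eq_at meromorphic_on_isolated_singularity) (use h in \<open>auto intro: meromorphic_on_subset\<close>)
  ultimately have "eventually (\<lambda>s. remove_sings ?h s = 0) (at z0)"
    by eventually_elim (use S in auto)
  then have "frequently (\<lambda>s. remove_sings ?h s = 0) (at z0)"
    by (intro eventually_frequently) auto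
  then have 0: "remove_sings ?h s = 0" for s
    by (rule frequently_eq_meromorphic_imp_constant[where A = UNIV])
       (auto intro: remove_sings_nicely_meromorphic h)
  have "eventually (\<lambda>s. remove_sings ?h s = ?h s) (at z)"
    by (intro eventually_remove_sings_eq_at meromorphic_on_isolated_singularity) (use h in \<open>auto intro: meromorphic_on_subset\<close>)
  then have "eventually (\<lambda>s. f s = g s) (at z)"
    by eventually_elim (simp add: 0)
  then have "remove_sings f z = remove_sings g z" by (intro remove_sings_cong) auto
  then show "f z = g z"
    using f g by (simp add: remove_sings_nicely_meromorphic_eq)
qed

text \<open>The definite description needs existence and uniqueness: \<open>remove_sings\<close>
  supplies a nicely meromorphic representative, and agreement on Re s > 1 determines it.\<close>

lemma multizeta_eq_remove_sings: "multizeta r = remove_sings (newton_zeta r)"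
proof -
  have n: "remove_sings (newton_zeta r) nicely_meromorphic_on UNIV"
    by (rule remove_sings_nicely_meromorphic[OF meromorphic_newton_zeta])
  have e: "remove_sings (newton_zeta r) s = multizeta_series r s" if s: "Re s > 1" for s
  proof -
    have "newton_zeta r analytic_on {s}"
    proof (rule analytic_newton_zeta)
      fix k :: nat assume "k \<ge> 1"
      then have "1 * 1 < real k * Re s" using s by (intro mult_le_less_imp_less) auto
      then show "of_nat k * s \<noteq> 1" by (auto simp: complex_eq_iff)
    qed
    then show ?thesis using newton_zeta_eq_multizeta_series[OF s] by simp
  qed
  show ?thesis
    unfolding multizeta_def
  proof (rule the_equality)
    fix f assume f: "f nicely_meromorphic_on UNIV \<and> (\<forall>s. 1 < Re s \<longrightarrow> f s = multizeta_series r s)"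
    show "f = remove_sings (newton_zeta r)"
      by (rule nicely_meromorphic_unique[of _ _ "{s. Re s > 1}" 2])
         (use f n e in \<open>auto simp: open_halfspace_Re_gt\<close>)
  qed (use n e in auto)
qed

lemma multizeta_eq_newton_zeta:
  assumes "x > 0"
  shows "multizeta r (of_real (- x)) = newton_zeta r (of_real (- x))"
proof -
  have "newton_zeta r analytic_on {of_real (- x)}"
  proof (rule analytic_newton_zeta)
    fix k :: nat assume "k \<ge> 1"
    then have "real k * x \<ge> 0" using assms by simp
    then show "of_nat k * complex_of_real (- x) \<noteq> 1" by (auto simp: complex_eq_iff)
  qed
  then show ?thesis by (simp add: multizeta_eq_remove_sings)
qed

section \<open>Values on the negative real axis\<close>

lemma zeta_of_real_neg:
  assumes "y > 0"
  shows "zeta (of_real (- y)) = of_real (- ((2 * pi) powr (- y) * sin (pi * y / 2) * mellin y / pi))"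
  using assms reflected_zeta_of_real[OF assms]
  by (simp add: zeta_eq_reflected_zeta mellin_def add.commute mult.assoc)

text \<open>In every product the arguments k x and (r - k) x add up to r x, so sign and power of 2
  pi are common to all summands. Dividing the \<open>mellin\<close> factors by
  \<open>mellin (r * x)\<close> leaves exactly the ratios in the recursion of
  \<open>normalized_zeta\<close>.\<close>

lemma newton_zeta_of_real_neg:
  assumes x: "x > 0" and r: "r \<ge> 1"
  shows "newton_zeta r (of_real (- x)) =
     of_real ((-1) ^ r * (2 * pi) powr (- (real r * x)) * mellin (real r * x) / (pi * real r) * normalized_zeta r x)"
  using r
proof (induction r rule: less_induct)
  case (less r)
  define A where "A = (-1) ^ r * (2 * pi) powr (- (real r * x)) * mellin (real r * x) / pi"
  define T where "T = (\<lambda>k. mellin_ratio k (r - k) x * (sin (real k * (pi * x / 2)) * normalized_zeta (r - k) x)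
        / (pi * real (r - k)))"
  obtain q where q [simp]: "r = Suc q" using less.prems by (cases r) auto
  have z: "zeta (of_nat k * of_real (- x)) =
      of_real (- ((2 * pi) powr (- (real k * x)) * sin (real k * (pi * x / 2)) * mellin (real k * x) / pi))"
    if "k \<ge> 1" for k
  proof -
    have "real k * x > 0" using that x by simp
    moreover have "of_nat k * complex_of_real (- x) = of_real (- (real k * x))" by simp
    moreover have "pi * (real k * x) / 2 = real k * (pi * x / 2)" by simp
    ultimately show ?thesis using zeta_of_real_neg[of "real k * x"] by (simp only:)
  qed
  have summand: "(-1) ^ k * zeta (of_nat (Suc k) * of_real (- x)) * newton_zeta (q - k) (of_real (- x))
      = of_real (A * T (Suc k))" if k: "k < q" for k
  proof -
    define j where "j = q - k"
    have j: "j < r" "j \<ge> 1" "r - Suc k = j" and rk: "r = Suc k + j" using k by (auto simp: j_def)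
    have pos: "mellin (real r * x) > 0" using x by (intro mellin_pos) auto
    have "real r * x = real (Suc k) * x + real j * x" unfolding rk by (simp add: algebra_simps)
    then have P: "(2 * pi) powr (- (real r * x)) = (2 * pi) powr (- (real (Suc k) * x)) * (2 * pi) powr (- (real j * x))"
      unfolding powr_add [symmetric] by simp
    have sgn: "(-1) ^ r = - ((-1) ^ k * (-1) ^ j :: real)" unfolding rk by (simp add: power_add)
    have rat: "mellin (real r * x) * mellin_ratio (Suc k) j x = mellin (real (Suc k) * x) * mellin (real j * x)"
    proof -
      have "real r = real (Suc k) + real j" unfolding rk by (simp only: of_nat_add)
      then show ?thesis using pos unfolding mellin_ratio_def by (simp only: nonzero_mult_div_cancel_left times_divide_eq_right)
    qed
    have "A * T (Suc k) = ((-1) ^ k * (-1) ^ j) * ((2 * pi) powr (- (real (Suc k) * x)) * (2 * pi) powr (- (real j * x)))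
        * - (mellin (real r * x) * mellin_ratio (Suc k) j x) * (sin (real (Suc k) * (pi * x / 2)) * normalized_zeta j x) / (pi * real j) / pi"
      unfolding A_def T_def j(3) sgn P by (simp add: mult_ac)
    also have "\<dots> = (-1) ^ k * - ((2 * pi) powr (- (real (Suc k) * x)) * sin (real (Suc k) * (pi * x / 2)) * mellin (real (Suc k) * x) / pi)
        * ((-1) ^ j * (2 * pi) powr (- (real j * x)) * mellin (real j * x) / (pi * real j) * normalized_zeta j x)"
      unfolding rat by (simp add: mult_ac)
    finally have AT: "A * T (Suc k) = (-1) ^ k * - ((2 * pi) powr (- (real (Suc k) * x)) * sin (real (Suc k) * (pi * x / 2)) * mellin (real (Suc k) * x) / pi)
        * ((-1) ^ j * (2 * pi) powr (- (real j * x)) * mellin (real j * x) / (pi * real j) * normalized_zeta j x)" .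
    have "newton_zeta (q - k) (of_real (- x)) = of_real ((-1) ^ j * (2 * pi) powr (- (real j * x)) * mellin (real j * x) / (pi * real j) * normalized_zeta j x)"
      using less.IH[OF j(1,2)] by (simp only: j_def)
    then show ?thesis
      unfolding AT using z[of "Suc k"] by (simp only: of_real_mult of_real_power of_real_minus of_real_1)
  qed
  \<comment> \<open>The summand k = q belongs to zeta(r s) and multiplies
    \<open>newton_zeta 0\<close>, which is 1; it yields the leading sine.\<close>
  have last: "(-1) ^ q * zeta (of_nat (Suc q) * of_real (- x)) * newton_zeta (q - q) (of_real (- x))
      = of_real (A * sin (real r * (pi * x / 2)))"
    using z[of "Suc q"] by (simp add: A_def)
  have "(\<Sum>k\<le>q. (-1) ^ k * zeta (of_nat (Suc k) * of_real (- x)) * newton_zeta (q - k) (of_real (- x)))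
     = (\<Sum>k<q. of_real (A * T (Suc k))) + of_real (A * sin (real r * (pi * x / 2)))"
    unfolding lessThan_Suc_atMost [symmetric] sum.lessThan_Suc last using summand by simp
  also have "\<dots> = of_real (A * (sin (real r * (pi * x / 2)) + (\<Sum>k<q. T (Suc k))))"
    by (simp add: sum_distrib_left distrib_left)
  also have "(\<Sum>k<q. T (Suc k)) = (\<Sum>k\<in>{1..<r}. T k)"
    by (rule sum.reindex_bij_witness[of _ "\<lambda>k. k - 1" Suc]) auto
  also have "sin (real r * (pi * x / 2)) + (\<Sum>k\<in>{1..<r}. T k) = normalized_zeta r x"
    unfolding T_def by (rule normalized_zeta.simps [symmetric])
  finally have "newton_zeta r (of_real (- x)) = of_real (A * normalized_zeta r x) / of_nat r"
    unfolding q newton_zeta.simps by (simp only:)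
  also have "\<dots> = of_real (A / real r * normalized_zeta r x)" by simp
  finally show ?case by (simp add: A_def)
qed

lemma multizeta_eq_0_iff:
  assumes "x > 0" "r \<ge> 1"
  shows "multizeta r (of_real (- x)) = 0 \<longleftrightarrow> normalized_zeta r x = 0"
proof -
  have "mellin (real r * x) > 0" using assms by (intro mellin_pos) auto
  then show ?thesis
    unfolding multizeta_eq_newton_zeta[OF assms(1)] newton_zeta_of_real_neg[OF assms] of_real_eq_0_iff
    using assms(2) by simp
qed

theorem theorem7:
  fixes r n :: nat
  assumes "r \<ge> 1" and "n \<ge> 2"
  shows "finite {x :: real. - 2 * real n < x \<and> x < - 2 * (real n - 1) \<and>
                   multizeta r (complex_of_real x) = 0} \<and>
         card {x :: real. - 2 * real n < x \<and> x < - 2 * (real n - 1) \<and>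
                   multizeta r (complex_of_real x) = 0} = r - 1"
proof -
  \<comment> \<open>From n >= 2 follows m >= 1, so the reflected interval (2 m, 2 m + 2) lies in the
    range x >= 2 of the estimates.\<close>
  define m where "m = n - 1"
  have m: "m \<ge> 1" "real n = real m + 1" using assms(2) by (auto simp: m_def of_nat_diff)
  let ?Z = "{x. 2 * real m < x \<and> x < 2 * real m + 2 \<and> normalized_zeta r x = 0}"
  have "{x. - 2 * real n < x \<and> x < - 2 * (real n - 1) \<and> multizeta r (complex_of_real x) = 0} = uminus ` ?Z"
  proof (intro equalityI subsetI)
    fix x assume "x \<in> {x. - 2 * real n < x \<and> x < - 2 * (real n - 1) \<and> multizeta r (complex_of_real x) = 0}"
    then have "- x \<in> ?Z" using multizeta_eq_0_iff[OF _ assms(1), of "- x"] m by auto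
    then show "x \<in> uminus ` ?Z" by (rule rev_image_eqI) simp
  next
    fix x assume "x \<in> uminus ` ?Z"
    then obtain y where "y \<in> ?Z" "x = - y" by blast
    then show "x \<in> {x. - 2 * real n < x \<and> x < - 2 * (real n - 1) \<and> multizeta r (complex_of_real x) = 0}"
      using multizeta_eq_0_iff[OF _ assms(1), of y] m by auto
  qed
  moreover have "finite ?Z \<and> card ?Z = r - 1"
    by (rule card_zeros_normalized_zeta[OF assms(1) m(1)])
  ultimately show ?thesis by (simp add: card_image)
qed

end
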